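(* Let $\bar s_1<\bar s_2<\dots<\bar s_{\mathcal L}$ be positive half-integers, with conventions $\bar s_0=0$, $\bar s_{\mathcal L+1}=\infty$, and put $\hbar_j=\frac{\pi}{2(\bar s_{j+1}-\bar s_j)}$ for $0\le j\le \mathcal L$ (so $\hbar_{\mathcal L}=0$), and $\mathcal R_j=\,]\bar s_j,\bar s_{j+1}[\,\cap\tfrac12\mathbb Z$. Let $\mathcal D_1,\dots,\mathcal D_{\mathcal L}$ be nonnegative integers, with $\mathcal D_0=\mathcal D_{\mathcal L+1}=0$, and let $\tilde\lambda_{j,d}\in\mathbb R$ ($1\le j\le\mathcal L$, $1\le d\le \mathcal D_j$) be hole rapidities. For each $m\in\mathcal R=\bigcup_{j=0}^{\mathcal L}\mathcal R_j$ let $\tilde\nu_m\ge0$ be an integer, only finitely many nonzero, and let $\lambda_{m,\ell}\in\mathbb R$ ($1\le\ell\le\tilde\nu_m$). For $1\le j\le \mathcal L$ define the (generalized) functions $$\mathfrak r_{\bar s_j}(\lambda)=\frac1{2\pi}\Big(\sum_{d=1}^{\mathcal D_{j-1}}\kappa^{(\hbar_{j-1})}_{2(\bar s_j-\bar s_{j-1})-1}(\lambda-\tilde\lambda_{j-1,d})+\sum_{d=1}^{\mathcal D_{j+1}}\kappa^{(\hbar_j)}_{2(\bar s_{j+1}-\bar s_j)-1}(\lambda-\tilde\lambda_{j+1,d})$$ $$\qquad+\sum_{d=1}^{\mathcal D_j}\big(\kappa^{(\hbar_j)}_1(\lambda-\tilde\lambda_{j,d})+\kappa^{(\hbar_{j-1})}_1(\lambda-\tilde\lambda_{j,d})-2\pi\delta(\lambda-\tilde\lambda_{j,d})\big)\Big),$$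 $$\mathfrak c_{\bar s_j}(\lambda)=-\frac1{2\pi}\sum_{m\in\mathcal R_{j-1}}\sum_{\ell=1}^{\tilde\nu_m}\gamma^{(\hbar_{j-1})}_{2(\bar s_j-m)}(\lambda-\lambda_{m,\ell})-\frac1{2\pi}\sum_{m\in\mathcal R_j}\sum_{\ell=1}^{\tilde\nu_m}\gamma^{(\hbar_j)}_{2(m-\bar s_j)}(\lambda-\lambda_{m,\ell}),$$ and for $s\in\{\bar s_1,\dots,\bar s_{\mathcal L}\}$ set $$\Delta E^{(s)}=-\sum_{j=1}^{\mathcal L}\int_{-\infty}^{\infty}\big(\mathfrak r_{\bar s_j}(\lambda)+\mathfrak c_{\bar s_j}(\lambda)\big)\Psi^{(\bar s_j)}_{2s}(\lambda)\,d\lambda-\sum_{m\in\mathcal R}\sum_{\ell=1}^{\tilde\nu_m}\Psi^{(m)}_{2s}(\lambda_{m,\ell}).$$ Then for every $1\le j\le\mathcal L$, $$\Delta E^{(\bar s_j)}=\sum_{d=1}^{\mathcal D_j}\frac{\pi}{\cosh(\pi\tilde\lambda_{j,d})}.$$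
   Context: Physical meaning: for an $L_0$-regular $gl(2)$ spin chain containing the spins $\bar s_1,\dots,\bar s_{\mathcal L}$ (densities $\rho_{\bar s_j}$), an excited state consists of $\mathcal D_j$ holes (rapidities $\tilde\lambda_{j,d}$) in the filled sea of $2\bar s_j$-strings and $\tilde\nu_m$ new $2m$-strings (centers $\lambda_{m,\ell}$) for spins $m\notin\{\bar s_j\}$; in the thermodynamic limit with string hypothesis the sea densities are $\rho_{\bar s_j}/(2\cosh\pi\lambda)+\frac1L(\mathfrak r_{\bar s_j}+\mathfrak c_{\bar s_j})$, and the energy density of $H^{(s)}$ is $\mathcal E_0^{(s)}+\frac1L\Delta E^{(s)}$ with $\Delta E^{(s)}$ as defined in the claim. Notation: the Fourier transform is $\hat f(p)=\frac1{2\pi}\int e^{ip\lambda}f(\lambda)d\lambda$. For $\hbar>0$ and $0<r<\pi/\hbar$, $\gamma^{(\hbar)}_r(\lambda)=\frac{2\hbar\sin(\hbar r)}{\cosh(2\hbar\lambda)-\cos(\hbar r)}$, with $\hat\gamma^{(\hbar)}_r(p)=\frac{\sinh(\frac p2(\frac\pi\hbar-r))}{\sinh(\frac{p\pi}{2\hbar})}$; for $\hbar=0$ and $r>0$, $\gamma^{(0)}_r(\lambda)=\frac{4r}{4\lambda^2+r^2}$, with $\hat\gamma^{(0)}_r(p)=e^{-r|p|/2}$; degenerate cases: $\gamma^{(\hbar)}_0=2\pi\delta$ ($\hat\gamma^{(\hbar)}_0=1$) and $\gamma^{(\hbar)}_{\pi/\hbar}=0$ ($\hat\gamma^{(\hbar)}_{\pi/\hbar}=0$).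 The function $\kappa^{(\hbar)}_r$ (for $0\le r\le\pi/\hbar$, resp. $r\ge 0$ when $\hbar=0$) is defined by its Fourier transform $\hat\kappa^{(\hbar)}_r(p)=\frac{\hat\gamma^{(\hbar)}_r(p)}{2\cosh(p/2)}$. For a positive integer $p$ and $m\in\frac12\mathbb Z_{>0}$, $\Psi^{(m)}_p(\lambda)=\sum_{\alpha=-m+\frac12}^{m-\frac12}f_{\alpha+\frac p2}(\lambda)$ (sum over $\alpha\in\{-m+\frac12,\dots,m-\frac12\}$ in steps of $1$), where $f_x(\lambda)=\frac{2x}{\lambda^2+x^2}$ for $x\ne0$ and $f_0\equiv0$. Terms with an empty range of summation are zero (e.g. all terms involving $\mathcal D_0$ or $\mathcal D_{\mathcal L+1}$). *)

theory Defs
  imports "HOL-Analysis.Analysis"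
begin

text \<open>Half-integers are encoded by their doubles (natural numbers):
  the spin s_j-bar is (S j)/2, and a spin m in R is encoded by M = 2m.\<close>

definition sb :: "(nat \<Rightarrow> nat) \<Rightarrow> nat \<Rightarrow> real" where
  "sb S j = (if j = 0 then 0 else real (S j) / 2)"

text \<open>hbar_j = pi / (2 (s_{j+1} - s_j)) for 0 <= j < L, and hbar_L = 0 (s_{L+1} = infinity).\<close>
definition hb :: "nat \<Rightarrow> (nat \<Rightarrow> nat) \<Rightarrow> nat \<Rightarrow> real" where
  "hb L S j = (if j \<ge> L then 0 else pi / (2 * (sb S (Suc j) - sb S j)))"

definition Rj :: "nat \<Rightarrow> (nat \<Rightarrow> nat) \<Rightarrow> nat \<Rightarrow> nat set" where
  "Rj L S j = {M. 2 * sb S j < real M \<and> (j < L \<longrightarrow> real M < 2 * sb S (Suc j))}"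

definition Rall :: "nat \<Rightarrow> (nat \<Rightarrow> nat) \<Rightarrow> nat set" where
  "Rall L S = (\<Union>j\<in>{0..L}. Rj L S j)"

definition Dc :: "nat \<Rightarrow> (nat \<Rightarrow> nat) \<Rightarrow> nat \<Rightarrow> nat" where
  "Dc L D j = (if 1 \<le> j \<and> j \<le> L then D j else 0)"

text \<open>Fourier transform of gamma^(hbar)_r (value at p = 0 is the continuous extension);
  covers the degenerate cases r = 0 and r = pi/hbar.\<close>
definition gamma_hat :: "real \<Rightarrow> real \<Rightarrow> real \<Rightarrow> real" where
  "gamma_hat h r p =
     (if h = 0 then exp (- r * \<bar>p\<bar> / 2)
      else if p = 0 then 1 - r * h / pi
      else sinh (p / 2 * (pi / h - r)) / sinh (p * pi / (2 * h)))"

definition kappa_hat :: "real \<Rightarrow> real \<Rightarrow> real \<Rightarrow> real" where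
  "kappa_hat h r p = gamma_hat h r p / (2 * cosh (p / 2))"

text \<open>kappa is the function with Fourier transform kappa_hat, with the convention
  fhat(p) = 1/(2 pi) int e^{i p x} f(x) dx, i.e. f(x) = int e^{-i p x} fhat(p) dp;
  kappa_hat is even, so this is the cosine integral.\<close>
definition kappa :: "real \<Rightarrow> real \<Rightarrow> real \<Rightarrow> real" where
  "kappa h r x = integral UNIV (\<lambda>p. cos (p * x) * kappa_hat h r p)"

text \<open>gamma^(hbar)_r for the non-degenerate cases (0 < r < pi/hbar, resp. r > 0 if hbar = 0).\<close>
definition gamma_fn :: "real \<Rightarrow> real \<Rightarrow> real \<Rightarrow> real" where
  "gamma_fn h r x =
     (if h = 0 then 4 * r / (4 * x\<^sup>2 + r\<^sup>2)
      else 2 * h * sin (h * r) / (cosh (2 * h * x) - cos (h * r)))"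

definition fx :: "real \<Rightarrow> real \<Rightarrow> real" where
  "fx a x = (if a = 0 then 0 else 2 * a / (x\<^sup>2 + a\<^sup>2))"

text \<open>Psi^(m)_p with m = M/2: alpha runs over -m+1/2, ..., m-1/2, i.e. alpha = k - m + 1/2, k < 2m.\<close>
definition Psi :: "nat \<Rightarrow> nat \<Rightarrow> real \<Rightarrow> real" where
  "Psi M p x = (\<Sum>k<M. fx (real k - real M / 2 + 1 / 2 + real p / 2) x)"

text \<open>Regular part of r_{s_j}; the delta term -2 pi delta(x - lt j d) is accounted for in DeltaE.\<close>
definition rreg :: "nat \<Rightarrow> (nat \<Rightarrow> nat) \<Rightarrow> (nat \<Rightarrow> nat) \<Rightarrow> (nat \<Rightarrow> nat \<Rightarrow> real)
                    \<Rightarrow> nat \<Rightarrow> real \<Rightarrow> real" where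
  "rreg L S D lt j x = (1 / (2 * pi)) *
     ((\<Sum>d = 1..Dc L D (j - 1).
         kappa (hb L S (j - 1)) (2 * (sb S j - sb S (j - 1)) - 1) (x - lt (j - 1) d))
    + (\<Sum>d = 1..Dc L D (Suc j).
         kappa (hb L S j) (2 * (sb S (Suc j) - sb S j) - 1) (x - lt (Suc j) d))
    + (\<Sum>d = 1..Dc L D j.
         kappa (hb L S j) 1 (x - lt j d) + kappa (hb L S (j - 1)) 1 (x - lt j d)))"

definition cfun :: "nat \<Rightarrow> (nat \<Rightarrow> nat) \<Rightarrow> (nat \<Rightarrow> nat) \<Rightarrow> (nat \<Rightarrow> nat \<Rightarrow> real)
                    \<Rightarrow> nat \<Rightarrow> real \<Rightarrow> real" where
  "cfun L S nu lam j x =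
     - (1 / (2 * pi)) * (\<Sum>M \<in> {M \<in> Rj L S (j - 1). 0 < nu M}. \<Sum>l = 1..nu M.
          gamma_fn (hb L S (j - 1)) (2 * (sb S j - real M / 2)) (x - lam M l))
     - (1 / (2 * pi)) * (\<Sum>M \<in> {M \<in> Rj L S j. 0 < nu M}. \<Sum>l = 1..nu M.
          gamma_fn (hb L S j) (2 * (real M / 2 - sb S j)) (x - lam M l))"

text \<open>Delta E^{(s)} for s = s_i (so 2s = S i). The term involving
  -(1/2pi) 2 pi delta(x - lt j d) integrates against Psi to - Psi(lt j d).\<close>
definition DeltaE :: "nat \<Rightarrow> (nat \<Rightarrow> nat) \<Rightarrow> (nat \<Rightarrow> nat) \<Rightarrow> (nat \<Rightarrow> nat \<Rightarrow> real)
                      \<Rightarrow> (nat \<Rightarrow> nat) \<Rightarrow> (nat \<Rightarrow> nat \<Rightarrow> real) \<Rightarrow> nat \<Rightarrow> real" where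
  "DeltaE L S D lt nu lam i =
     - (\<Sum>j = 1..L.
          integral UNIV (\<lambda>x. (rreg L S D lt j x + cfun L S nu lam j x) * Psi (S j) (S i) x)
          - (\<Sum>d = 1..Dc L D j. Psi (S j) (S i) (lt j d)))
     - (\<Sum>M \<in> {M \<in> Rall L S. 0 < nu M}. \<Sum>l = 1..nu M. Psi M (S i) (lam M l))"

end

theory Submission
  imports Defs "HOL-Real_Asymp.Real_Asymp" "HOL-Complex_Analysis.Complex_Analysis"
begin

text \<open>By Parseval every integral against \<open>Psi\<close> becomes an integral over the Fourier variable \<open>p\<close>.
  As a function of the spin, the transform of \<open>Psi\<close> is a piecewise exponential Green's function
  with its only kink at the spin \<open>s\<close> of the Hamiltonian, and the transforms of \<open>gamma\<close> interpolate such functions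
  between neighbouring sites. Hence the backflow of a new string cancels its bare energy, and the
  backflow of a hole, together with its bare energy, is the Green's function equation at the site of the hole:
  it vanishes unless that site carries the spin \<open>s\<close>, where \<open>1 / (2 cosh (p / 2))\<close> remains, the transform of
  \<open>pi / cosh (pi x)\<close>.\<close>

section \<open>Integrals over the real line by residues\<close>

text \<open>\<open>kappa\<close> is known only through its transform, whereas
  \<open>gamma_fn\<close> and \<open>Psi\<close> are closed formulas. Parseval therefore occurs in
  two roles: against \<open>kappa\<close> the transform of \<open>Psi\<close> is computed, against
  \<open>gamma_fn\<close> the transform of \<open>gamma_fn\<close> is computed and
  \<open>Psi\<close> is written as a cosine integral. This is why the transform of \<open>fx\<close>
  is established in both directions, without Fourier inversion. Identities between transforms are
  needed for \<open>p \<noteq> 0\<close> only, that is, almost everywhere. The Green's function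
  equation couples consecutive doubled spins, while the gaps of the chain are arbitrary. The indices
  1 and gap - 1 of \<open>kappa\<close> bridge this: with them, interpolation from the two ends of a
  gap gives the value one unit inside it. A hole borders two gaps and so produces both
  \<open>F (n + 1)\<close> and \<open>F (n - 1)\<close>, each over \<open>2 * cosh (p / 2)\<close>;
  the delta term supplies \<open>- F n\<close>.\<close>

lemma integral_symmetric_interval_tendsto:
  fixes f :: "real \<Rightarrow> 'a::euclidean_space"
  assumes f: "integrable lborel f"
  shows "(\<lambda>n. integral {- real n..real n} f) \<longlonglongrightarrow> (LINT x|lborel. f x)"
proof -
  have "set_integrable lborel {- real n..real n} f" for n
    unfolding set_integrable_def by (rule integrable_mult_indicator[OF _ f]) simp
  then have eq: "integral {- real n..real n} f = (LINT x|lborel. indicator {- real n..real n} x *\<^sub>R f x)" for n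
    using set_borel_integral_eq_integral(2) unfolding set_lebesgue_integral_def by metis
  have "(\<lambda>n. LINT x|lborel. indicator {- real n..real n} x *\<^sub>R f x) \<longlonglongrightarrow> (LINT x|lborel. f x)"
  proof (rule integral_dominated_convergence[where w="\<lambda>x. norm (f x)"])
    show "AE x in lborel. (\<lambda>n. indicator {- real n..real n} x *\<^sub>R f x) \<longlonglongrightarrow> f x"
    proof (rule AE_I2)
      fix x :: real
      have "\<forall>\<^sub>F n in sequentially. indicator {- real n..real n} x *\<^sub>R f x = f x"
        using eventually_ge_at_top[of "nat \<lceil>\<bar>x\<bar>\<rceil>"]
      proof eventually_elim
        case (elim n)
        then have "\<bar>x\<bar> \<le> real n" by linarith
        then show ?case by (auto simp: indicator_def)
      qed
      then show "(\<lambda>n. indicator {- real n..real n} x *\<^sub>R f x) \<longlonglongrightarrow> f x"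
        by (rule tendsto_eventually)
    qed
  qed (use f in \<open>auto simp: indicator_def intro!: AE_I2\<close>)
  then show ?thesis by (simp add: eq)
qed

text \<open>For a nonnegative integrand, finite limits of the antiderivative give integrability
  along with the value.\<close>

lemma has_bochner_integral_lborel_antiderivative:
  fixes f F :: "real \<Rightarrow> real"
  assumes F: "\<And>x. DERIV F x :> f x" and f: "\<And>x. isCont f x" and nn: "\<And>x. 0 \<le> f x"
    and A: "(F \<longlongrightarrow> A) at_bot" and B: "(F \<longlongrightarrow> B) at_top"
  shows "has_bochner_integral lborel f (B - A)"
proof -
  have *: "((F \<circ> real_of_ereal) \<longlongrightarrow> A) (at_right (-\<infinity>))" "((F \<circ> real_of_ereal) \<longlongrightarrow> B) (at_left \<infinity>)"
    using A B by (simp_all add: ereal_tendsto_simps)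
  have "set_integrable lborel (einterval (-\<infinity>) \<infinity>) f" "(LBINT x=-\<infinity>..\<infinity>. f x) = B - A"
    by (rule interval_integral_FTC_nonneg[OF _ _ _ _ *]; simp add: F f nn)+
  then show ?thesis
    by (simp add: has_bochner_integral_iff set_integrable_def interval_lebesgue_integral_def
        set_lebesgue_integral_def)
qed

text \<open>Each vertical side has length \<open>b\<close> and contributes at most
  \<open>b * B\<close>. The upper side stays in the formula as an integral: for \<open>fx\<close> it
  is estimated, for \<open>gamma_fn\<close> it is a multiple of the lower side.\<close>

lemma rectangle_residue_bound:
  fixes f :: "complex \<Rightarrow> complex"
  assumes S: "open S" "convex S" and fin: "finite pts" and holo: "f holomorphic_on S - pts"
    and R: "0 < R" and b: "0 < b"
    and sub: "cbox (Complex (-R) 0) (Complex R b) \<subseteq> S"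
    and pts: "pts \<subseteq> box (Complex (-R) 0) (Complex R b)"
    and right: "\<And>y. 0 \<le> y \<Longrightarrow> y \<le> b \<Longrightarrow> norm (f (Complex R y)) \<le> B"
    and left: "\<And>y. 0 \<le> y \<Longrightarrow> y \<le> b \<Longrightarrow> norm (f (Complex (-R) y)) \<le> B"
  shows "norm (integral {-R..R} (\<lambda>x. f (of_real x)) - integral {-R..R} (\<lambda>x. f (of_real x + \<i> * of_real b))
           - 2 * of_real pi * \<i> * (\<Sum>w\<in>pts. residue f w)) \<le> 2 * b * B"
proof -
  define a1 a2 a3 a4 where "a1 = Complex (-R) 0" "a2 = Complex R 0" "a3 = Complex R b" "a4 = Complex (-R) b"
  note a_defs = this
  have ab: "rectpath a1 a3 = linepath a1 a2 +++ linepath a2 a3 +++ linepath a3 a4 +++ linepath a4 a1"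
    by (simp add: rectpath_def a_defs Let_def)
  have img: "path_image (rectpath a1 a3) \<subseteq> S - pts"
    using sub pts path_image_rectpath_cbox_minus_box[of a1 a3] R b by (auto simp: a_defs)
  have cont: "continuous_on (S - pts) f"
    using holo by (rule holomorphic_on_imp_continuous_on)
  have segs: "closed_segment a1 a2 \<subseteq> S - pts" "closed_segment a2 a3 \<subseteq> S - pts"
      "closed_segment a3 a4 \<subseteq> S - pts" "closed_segment a4 a1 \<subseteq> S - pts"
    using img by (auto simp: ab path_image_join)
  have int: "f contour_integrable_on linepath a1 a2" "f contour_integrable_on linepath a2 a3"
      "f contour_integrable_on linepath a3 a4" "f contour_integrable_on linepath a4 a1"
    using segs cont by (auto intro!: contour_integrable_continuous_linepath intro: continuous_on_subset)
  have "contour_integral (rectpath a1 a3) f = 2 * pi * \<i> * (\<Sum>w\<in>pts. winding_number (rectpath a1 a3) w * residue f w)"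
  proof (rule Residue_theorem[OF S(1) _ fin holo])
    show "connected S" using S by (simp add: convex_connected)
    show "\<forall>z. z \<notin> S \<longrightarrow> winding_number (rectpath a1 a3) z = 0"
      using winding_number_zero_outside[of "rectpath a1 a3" S] img S(2) by auto
  qed (use img in auto)
  also have "(\<Sum>w\<in>pts. winding_number (rectpath a1 a3) w * residue f w) = (\<Sum>w\<in>pts. residue f w)"
    using pts winding_number_rectpath[of _ a1 a3] by (intro sum.cong) (auto simp: a_defs)
  also have "contour_integral (rectpath a1 a3) f =
     contour_integral (linepath a1 a2) f + (contour_integral (linepath a2 a3) f
       + (contour_integral (linepath a3 a4) f + contour_integral (linepath a4 a1) f))"
    using int by (simp add: ab)
  also have "contour_integral (linepath a1 a2) f = integral {-R..R} (\<lambda>x. f (of_real x))"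
    using contour_integral_linepath_Reals_eq[of a1 a2 f] R by (simp add: a_defs complex_is_Real_iff)
  also have "contour_integral (linepath a3 a4) f = - contour_integral (linepath a4 a3) f"
    using contour_integral_reverse_linepath[of a3 a4 f] segs(3) cont
    by (metis add.inverse_inverse closed_segment_commute continuous_on_subset)
  also have "contour_integral (linepath a4 a3) f = contour_integral (linepath a1 a2) (\<lambda>z. f (z + \<i> * of_real b))"
  proof -
    have "linepath a4 a3 x = linepath a1 a2 x + \<i> * of_real b" for x
      by (simp add: linepath_def a_defs complex_eq_iff algebra_simps)
    moreover have "a3 - a4 = a2 - a1" by (simp add: a_defs complex_eq_iff)
    ultimately show ?thesis
      by (simp add: contour_integral_integral)
  qed
  also have "\<dots> = integral {-R..R} (\<lambda>x. f (of_real x + \<i> * of_real b))"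
    using contour_integral_linepath_Reals_eq[of a1 a2 "\<lambda>z. f (z + \<i> * of_real b)"] R
    by (simp add: a_defs complex_is_Real_iff)
  finally have eq: "integral {-R..R} (\<lambda>x. f (of_real x)) - integral {-R..R} (\<lambda>x. f (of_real x + \<i> * of_real b))
           - 2 * of_real pi * \<i> * (\<Sum>w\<in>pts. residue f w)
       = - (contour_integral (linepath a2 a3) f + contour_integral (linepath a4 a1) f)"
    by (simp add: algebra_simps)
  have B: "0 \<le> B" using right[of 0] b norm_ge_zero[of "f (Complex R 0)"] by linarith
  have "norm (contour_integral (linepath a2 a3) f) \<le> B * norm (a3 - a2)"
  proof (rule contour_integral_bound_linepath[OF int(2) B])
    fix x assume "x \<in> closed_segment a2 a3"
    then have "Re x = R" "Im x \<in> {0..b}"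
      using b by (auto simp: a_defs closed_segment_same_Re closed_segment_eq_real_ivl)
    then show "norm (f x) \<le> B" using right[of "Im x"] by (metis atLeastAtMost_iff complex.collapse)
  qed
  moreover have "norm (contour_integral (linepath a4 a1) f) \<le> B * norm (a1 - a4)"
  proof (rule contour_integral_bound_linepath[OF int(4) B])
    fix x assume "x \<in> closed_segment a4 a1"
    then have "Re x = -R" "Im x \<in> {0..b}"
      using b by (auto simp: a_defs closed_segment_same_Re closed_segment_eq_real_ivl)
    then show "norm (f x) \<le> B" using left[of "Im x"] by (metis atLeastAtMost_iff complex.collapse)
  qed
  moreover have "norm (a3 - a2) = b" "norm (a1 - a4) = b"
    using b by (simp_all add: a_defs cmod_def)
  ultimately have "norm (contour_integral (linepath a2 a3) f + contour_integral (linepath a4 a1) f) \<le> 2 * b * B"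
    using norm_triangle_ineq[of "contour_integral (linepath a2 a3) f" "contour_integral (linepath a4 a1) f"]
    by (simp add: mult.commute)
  then show ?thesis unfolding eq norm_minus_cancel .
qed

section \<open>Fourier transforms of the kernels\<close>

lemma has_bochner_integral_fx:
  assumes a: "0 < a"
  shows "has_bochner_integral lborel (fx a) (2 * pi)"
proof -
  have "has_bochner_integral lborel (fx a) (pi - (- pi))"
  proof (rule has_bochner_integral_lborel_antiderivative[where F = "\<lambda>x. 2 * arctan (x / a)"])
    show "((\<lambda>x. 2 * arctan (x / a)) has_real_derivative fx a x) (at x)" for x
      using a by (auto intro!: derivative_eq_intros simp: fx_def field_simps power2_eq_square)
    show "isCont (fx a) x" for x
      using a unfolding fx_def
      by (auto intro!: continuous_intros simp: add_nonneg_eq_0_iff)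
    show "0 \<le> fx a x" for x using a by (simp add: fx_def)
    show "((\<lambda>x. 2 * arctan (x / a)) \<longlongrightarrow> - pi) at_bot" using a by real_asymp
    show "((\<lambda>x. 2 * arctan (x / a)) \<longlongrightarrow> pi) at_top" using a by real_asymp
  qed
  then show ?thesis by simp
qed

lemma has_bochner_integral_sech:
  fixes c :: real
  assumes c: "0 < c"
  shows "has_bochner_integral lborel (\<lambda>x. 1 / cosh (c * x)) (pi / c)"
proof -
  have "has_bochner_integral lborel (\<lambda>x. 1 / cosh (c * x)) (pi / c - 0)"
  proof (rule has_bochner_integral_lborel_antiderivative[where F = "\<lambda>x. 2 / c * arctan (exp (c * x))"])
    show "((\<lambda>x. 2 / c * arctan (exp (c * x))) has_real_derivative 1 / cosh (c * x)) (at x)" for x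
    proof -
      have "1 / cosh (c * x) = 2 * exp (c * x) / (1 + (exp (c * x))\<^sup>2)"
        by (simp add: cosh_field_def exp_minus field_simps power2_eq_square)
      moreover have "0 < 1 + (exp (c * x))\<^sup>2" by (simp add: add_pos_nonneg)
      ultimately show ?thesis
        using c by (auto intro!: derivative_eq_intros simp: field_simps)
    qed
    show "isCont (\<lambda>x. 1 / cosh (c * x)) x" for x
      by (auto intro!: continuous_intros)
    show "((\<lambda>x. 2 / c * arctan (exp (c * x))) \<longlongrightarrow> 0) at_bot" using c by real_asymp
    show "((\<lambda>x. 2 / c * arctan (exp (c * x))) \<longlongrightarrow> pi / c) at_top" using c by real_asymp
  qed simp
  then show ?thesis by simp
qed

text \<open>Comparison with the hyperbolic secant avoids the kink of the exponent at 0.\<close>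

lemma integrable_exp_minus_abs:
  fixes c :: real
  assumes c: "0 < c"
  shows "integrable lborel (\<lambda>x. exp (- c * \<bar>x\<bar>))"
proof (rule Bochner_Integration.integrable_bound)
  show "integrable lborel (\<lambda>x. 1 / cosh (c * x))"
    using has_bochner_integral_sech[OF c] by (simp add: has_bochner_integral_iff)
  have "cosh y \<le> exp \<bar>y\<bar>" for y :: real
  proof -
    have "0 \<le> sinh \<bar>y\<bar>" by simp
    then show ?thesis using cosh_plus_sinh[of "\<bar>y\<bar>"] cosh_real_abs[of y] by linarith
  qed
  from this[of "c * _"] show "AE x in lborel. norm (exp (- c * \<bar>x\<bar>)) \<le> norm (1 / cosh (c * x))"
    using c by (intro AE_I2) (simp add: exp_minus field_simps abs_mult)
qed auto

lemma fx_eq_cos_integral: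
  assumes a: "0 < a"
  shows "(LINT p|lborel. cos (p * x) * exp (- a * \<bar>p\<bar>)) = fx a x"
proof -
  \<comment> \<open>The real part of \<open>exp ((- a + \<i> * x) * p) / (- a + \<i> * x)\<close>,
    an antiderivative of the integrand on the half line \<open>p \<ge> 0\<close>; the other half
    follows by evenness.\<close>
  define F where "F p = exp (- a * p) * (x * sin (p * x) - a * cos (p * x)) / (a\<^sup>2 + x\<^sup>2)" for p
  have nz: "0 < a\<^sup>2 + x\<^sup>2" using a by (simp add: add_pos_nonneg)
  let ?f = "\<lambda>p. cos (p * x) * exp (- a * \<bar>p\<bar>)"
  have int: "integrable lborel ?f"
    by (rule Bochner_Integration.integrable_bound[OF integrable_exp_minus_abs[OF a]]) (auto simp: abs_mult)
  have right: "(?f has_integral F (real n) - F 0) {0..real n}" for n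
  proof -
    have "((\<lambda>p. cos (p * x) * exp (- a * p)) has_integral F (real n) - F 0) {0..real n}"
    proof (rule fundamental_theorem_of_calculus)
      fix p
      have "(F has_real_derivative cos (p * x) * exp (- a * p)) (at p)"
        unfolding F_def using nz
        by (auto intro!: derivative_eq_intros simp: divide_eq_eq)
          (simp_all add: algebra_simps power2_eq_square)
      then show "(F has_vector_derivative cos (p * x) * exp (- a * p)) (at p within {0..real n})"
        by (simp add: has_real_derivative_iff_has_vector_derivative has_vector_derivative_at_within)
    qed simp
    then show ?thesis by (rule has_integral_eq[rotated]) simp
  qed
  have left: "(?f has_integral F (real n) - F 0) {- real n..0}" for n
    using right[of n] has_integral_reflect_real[of ?f "F (real n) - F 0" "real n" 0] by simp
  have "integral {- real n..real n} ?f = 2 * (F (real n) - F 0)" for n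
    using has_integral_combine[OF _ _ left[of n] right[of n]] by (simp add: integral_unique)
  moreover have "(\<lambda>n. 2 * (F (real n) - F 0)) \<longlonglongrightarrow> 2 * (0 - F 0)"
  proof (intro tendsto_intros)
    show "(\<lambda>n. F (real n)) \<longlonglongrightarrow> 0"
    proof (rule Lim_null_comparison)
      show "\<forall>\<^sub>F n in sequentially. norm (F (real n)) \<le> exp (- a * real n) * ((\<bar>x\<bar> + a) / (a\<^sup>2 + x\<^sup>2))"
      proof (rule always_eventually, rule allI)
        fix n
        have "\<bar>x * sin (real n * x) - a * cos (real n * x)\<bar> \<le> \<bar>x\<bar> * \<bar>sin (real n * x)\<bar> + a * \<bar>cos (real n * x)\<bar>"
          using a abs_triangle_ineq4[of "x * sin (real n * x)" "a * cos (real n * x)"] by (simp add: abs_mult)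
        also have "\<dots> \<le> \<bar>x\<bar> * 1 + a * 1" using a by (intro add_mono mult_left_mono) auto
        finally show "norm (F (real n)) \<le> exp (- a * real n) * ((\<bar>x\<bar> + a) / (a\<^sup>2 + x\<^sup>2))"
          using nz by (simp add: F_def abs_mult divide_right_mono)
      qed
      have "(\<lambda>n. exp (- a * real n)) \<longlonglongrightarrow> 0" using a by real_asymp
      then show "(\<lambda>n. exp (- a * real n) * ((\<bar>x\<bar> + a) / (a\<^sup>2 + x\<^sup>2))) \<longlonglongrightarrow> 0"
        by (rule tendsto_mult_left_zero)
    qed
  qed
  ultimately have "(LINT p|lborel. ?f p) = 2 * (0 - F 0)"
    using integral_symmetric_interval_tendsto[OF int] LIMSEQ_unique by simp
  also have "\<dots> = fx a x" using a nz by (simp add: F_def fx_def add.commute)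
  finally show ?thesis .
qed

lemma two_pi_i_mult_divide_i: "2 * of_real P * \<i> * (of_real E / \<i>) = of_real (2 * P * E)"
  by (simp add: complex_eq_iff)

lemma cos_integral_fx:
  assumes a: "0 < a"
  shows "(LINT x|lborel. fx a x * cos (p * x)) = 2 * pi * exp (- a * \<bar>p\<bar>)"
proof -
  \<comment> \<open>The cosine is even in \<open>p\<close>, and a nonnegative frequency keeps
    \<open>exp (\<i> * q * z)\<close> bounded by 1 in the upper half plane.\<close>
  define q where "q = \<bar>p\<bar>"
  have q: "0 \<le> q" by (simp add: q_def)
  define f where "f z = exp (\<i> * of_real q * z) * of_real (2 * a) / (z + \<i> * of_real a) / (z - \<i> * of_real a)" for z
  \<comment> \<open>The half plane ends exactly at the second pole \<open>- \<i> * a\<close>, which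
    is thereby excluded.\<close>
  define S where "S = {z. - a < Im z}"
  have nzp: "z + \<i> * of_real a \<noteq> 0" if "z \<in> S" for z
    using that a by (auto simp: S_def complex_eq_iff)
  have f_alt: "f z = exp (\<i> * of_real q * z) * of_real (2 * a) / (z\<^sup>2 + (of_real a)\<^sup>2)" for z
    by (simp add: f_def power2_eq_square algebra_simps)
  have Re: "f (of_real x) = of_real (fx a x) * exp (\<i> * of_real (q * x))" for x
    using a by (simp add: f_alt fx_def mult.assoc)
  have int: "integrable lborel (\<lambda>x. f (of_real x))"
  proof (rule Bochner_Integration.integrable_bound[of _ "fx a"])
    show "integrable lborel (fx a)" using has_bochner_integral_fx[OF a] by (simp add: has_bochner_integral_iff)
    show "(\<lambda>x. f (of_real x)) \<in> borel_measurable lborel" unfolding f_alt by measurable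
    show "AE x in lborel. norm (f (of_real x)) \<le> norm (fx a x)" unfolding Re by (simp add: norm_mult)
  qed
  have holo: "f holomorphic_on S - {\<i> * of_real a}"
    unfolding f_def using nzp by (auto intro!: holomorphic_intros)
  have opn: "open S" unfolding S_def by (rule open_halfspace_Im_gt)
  have cvx: "convex S" unfolding S_def by (rule convex_halfspace_Im_gt)
  have res: "residue f (\<i> * of_real a) = of_real (exp (- a * q)) / \<i>"
  proof -
    have "residue f (\<i> * of_real a) = exp (\<i> * of_real q * (\<i> * of_real a)) * of_real (2 * a) / (\<i> * of_real a + \<i> * of_real a)"
      unfolding f_def using a nzp
      by (intro residue_simple[OF opn]) (auto intro!: holomorphic_intros simp: S_def)
    also have "\<dots> = of_real (exp (- a * q)) / \<i>"
      using a by (simp add: field_simps flip: exp_of_real)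
    finally show ?thesis .
  qed
  \<comment> \<open>The rectangle has height \<open>n\<close>: its two vertical sides and its upper
    side have total length \<open>4 * n\<close>, and on each of them the integrand is at most
    \<open>2 * a / (n^2 - a^2)\<close>.\<close>
  have bound: "norm (integral {- real n..real n} (\<lambda>x. f (of_real x)) - of_real (2 * pi * exp (- a * q)))
       \<le> 8 * a * real n / ((real n)\<^sup>2 - a\<^sup>2)" if n: "real n > a" for n
  proof -
    have tri: "norm (I - c) \<le> X + Y" if "norm (I - J - c) \<le> X" "norm J \<le> Y" for I J c :: complex and X Y
      using norm_triangle_ineq[of "I - J - c" J] that by (simp add: algebra_simps)
    define B where "B = 2 * a / ((real n)\<^sup>2 - a\<^sup>2)"
    have d: "0 < (real n)\<^sup>2 - a\<^sup>2" using n a by (simp add: power_strict_mono)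
    have fB: "norm (f z) \<le> B" if z: "real n \<le> norm z" "0 \<le> Im z" for z
    proof -
      have "(real n)\<^sup>2 - a\<^sup>2 \<le> (norm z)\<^sup>2 - a\<^sup>2" using z by (simp add: power_mono)
      also have "\<dots> \<le> norm (z\<^sup>2 + (of_real a)\<^sup>2)"
        using norm_triangle_ineq2[of "z\<^sup>2" "- (of_real a)\<^sup>2"] by (simp add: norm_power)
      finally have "(real n)\<^sup>2 - a\<^sup>2 \<le> norm (z\<^sup>2 + (of_real a)\<^sup>2)" .
      moreover have "norm (exp (\<i> * of_real q * z)) \<le> 1" using q z by simp
      ultimately show ?thesis
        unfolding f_alt B_def norm_divide norm_mult using a d
        by (intro frac_le) (auto simp: mult_left_le_one_le)
    qed
    have "norm (integral {- real n..real n} (\<lambda>x. f (of_real x))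
         - integral {- real n..real n} (\<lambda>x. f (of_real x + \<i> * of_real (real n)))
           - 2 * of_real pi * \<i> * (\<Sum>w\<in>{\<i> * of_real a}. residue f w)) \<le> 2 * real n * B"
    proof (rule rectangle_residue_bound[OF opn cvx _ holo])
      show "cbox (Complex (- real n) 0) (Complex (real n) (real n)) \<subseteq> S"
        using a by (auto simp: S_def in_cbox_complex_iff)
      show "{\<i> * of_real a} \<subseteq> box (Complex (- real n) 0) (Complex (real n) (real n))"
        using a n by (auto simp: in_box_complex_iff)
      show "norm (f (Complex (real n) y)) \<le> B" "norm (f (Complex (- real n) y)) \<le> B" if "0 \<le> y" "y \<le> real n" for y
        using that abs_Re_le_cmod[of "Complex (real n) y"] abs_Re_le_cmod[of "Complex (- real n) y"]
        by (auto intro!: fB)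
    qed (use a n in auto)
    moreover have "norm (integral {- real n..real n} (\<lambda>x. f (of_real x + \<i> * of_real (real n)))) \<le> B * (real n - (- real n))"
    proof (rule integral_bound)
      have "continuous_on (S - {\<i> * of_real a}) f" using holo by (rule holomorphic_on_imp_continuous_on)
      then show "continuous_on {- real n..real n} (\<lambda>x. f (of_real x + \<i> * of_real (real n)))"
        by (rule continuous_on_compose2) (use a n in \<open>auto intro!: continuous_intros simp: S_def complex_eq_iff\<close>)
      fix t
      have "real n \<le> norm (of_real t + \<i> * of_real (real n))"
        using abs_Im_le_cmod[of "of_real t + \<i> * of_real (real n)"] by simp
      then show "norm (f (of_real t + \<i> * of_real (real n))) \<le> B" by (intro fB) auto
    qed simp
    moreover have "2 * of_real pi * \<i> * (\<Sum>w\<in>{\<i> * of_real a}. residue f w) = of_real (2 * pi * exp (- a * q))"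
      by (subst sum.insert; simp only: finite.emptyI empty_iff not_False_eq_True sum.empty add_0_right res two_pi_i_mult_divide_i)
    ultimately have "norm (integral {- real n..real n} (\<lambda>x. f (of_real x)) - of_real (2 * pi * exp (- a * q)))
        \<le> 2 * real n * B + B * (real n - (- real n))"
      using tri by metis
    then show ?thesis by (simp add: B_def mult_ac)
  qed
  have "(\<lambda>n. integral {- real n..real n} (\<lambda>x. f (of_real x)) - of_real (2 * pi * exp (- a * q))) \<longlonglongrightarrow> 0"
  proof (rule Lim_null_comparison)
    show "\<forall>\<^sub>F n in sequentially. norm (integral {- real n..real n} (\<lambda>x. f (of_real x)) - of_real (2 * pi * exp (- a * q)))
       \<le> 8 * a * real n / ((real n)\<^sup>2 - a\<^sup>2)"
      using eventually_gt_at_top[of "nat \<lceil>a\<rceil>"] by eventually_elim (rule bound, linarith)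
    show "(\<lambda>n. 8 * a * real n / ((real n)\<^sup>2 - a\<^sup>2)) \<longlonglongrightarrow> 0" by real_asymp
  qed
  then have "(\<lambda>n. integral {- real n..real n} (\<lambda>x. f (of_real x))) \<longlonglongrightarrow> of_real (2 * pi * exp (- a * q))"
    by (simp only: LIM_zero_iff)
  with integral_symmetric_interval_tendsto[OF int]
  have "(LINT x|lborel. f (of_real x)) = of_real (2 * pi * exp (- a * q))" by (rule LIMSEQ_unique)
  then have "Re (LINT x|lborel. f (of_real x)) = 2 * pi * exp (- a * q)" by (simp only: Re_complex_of_real)
  moreover have "Re (LINT x|lborel. f (of_real x)) = (LINT x|lborel. Re (f (of_real x)))"
    by (rule integral_Re[OF int, symmetric])
  moreover have "Re (f (of_real x)) = fx a x * cos (p * x)" for x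
    unfolding Re by (cases "0 \<le> p") (simp_all add: q_def Re_exp)
  ultimately show ?thesis by (simp add: q_def)
qed

section \<open>Size and zeros of \<open>cosh w - cos t\<close> in a horizontal strip\<close>

lemma Re_cosh: "Re (cosh w) = cosh (Re w) * cos (Im w)"
  and Im_cosh: "Im (cosh w) = sinh (Re w) * sin (Im w)"
  by (simp_all add: cosh_field_def sinh_field_def Re_exp Im_exp algebra_simps)

lemma abs_sinh_Re_le_norm_cosh: "\<bar>sinh (Re w)\<bar> \<le> norm (cosh w)"
proof -
  have "exp (Re w) - exp (- Re w) \<le> norm (exp w + exp (- w))"
    using norm_triangle_ineq2[of "exp w" "- exp (- w)"] by simp
  moreover have "exp (- Re w) - exp (Re w) \<le> norm (exp w + exp (- w))"
    using norm_triangle_ineq2[of "exp (- w)" "- exp w"] by (simp add: add.commute)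
  ultimately show ?thesis
    by (simp add: cosh_field_def sinh_field_def norm_divide abs_le_iff)
qed

text \<open>The open interval ends at the solutions \<open>- t\<close> and
  \<open>2 * pi + t\<close>, so it is the largest one around \<open>[0, 2 * pi]\<close> that
  contains just the two solutions listed.\<close>

lemma cos_eq_cos_cases:
  fixes v t :: real
  assumes t: "0 < t" "t < pi" and v: "- t < v" "v < 2 * pi + t" and eq: "cos v = cos t"
  shows "v = t \<or> v = 2 * pi - t"
proof -
  consider "v < 0" | "0 \<le> v" "v \<le> pi" | "pi < v" "v \<le> 2 * pi" | "2 * pi < v" by linarith
  then show ?thesis
  proof cases
    case 1
    have "cos (- v) = cos t" using eq by (simp only: cos_minus)
    then have "- v = t" by (rule cos_inj_pi[rotated 4]) (use 1 t v in linarith)+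
    then show ?thesis using v by linarith
  next
    case 2
    have "v = t" by (rule cos_inj_pi[OF _ _ _ _ eq]) (use 2 t in linarith)+
    then show ?thesis by blast
  next
    case 3
    have "cos (2 * pi - v) = cos t" by (simp add: cos_diff eq)
    then have "2 * pi - v = t" by (rule cos_inj_pi[rotated 4]) (use 3 t in linarith)+
    then show ?thesis by linarith
  next
    case 4
    have "cos (v - 2 * pi) = cos t" by (simp add: cos_diff eq)
    then have "v - 2 * pi = t" by (rule cos_inj_pi[rotated 4]) (use 4 t v in linarith)+
    then show ?thesis using v by linarith
  qed
qed

text \<open>The imaginary part of the equation forces \<open>Re w = 0\<close> or
  \<open>sin (Im w) = 0\<close>. In the second case \<open>\<bar>cos t\<bar> = cosh (Re w)\<close>,
  which exceeds 1 unless \<open>Re w = 0\<close>.\<close>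

lemma cosh_eq_cos_strip:
  fixes w :: complex and t :: real
  assumes t: "0 < t" "t < pi" and w: "- t < Im w" "Im w < 2 * pi + t" and eq: "cosh w = of_real (cos t)"
  shows "w = \<i> * of_real t \<or> w = \<i> * of_real (2 * pi - t)"
proof -
  have re: "cosh (Re w) * cos (Im w) = cos t" and im: "sinh (Re w) * sin (Im w) = 0"
    using arg_cong[OF eq, of Re] arg_cong[OF eq, of Im] by (simp_all add: Re_cosh Im_cosh)
  have "Re w = 0"
  proof (rule ccontr)
    assume nz: "Re w \<noteq> 0"
    then have "sin (Im w) = 0" using im by simp
    then have "\<bar>cos (Im w)\<bar> = 1" using sin_zero_abs_cos_one by blast
    then have "\<bar>cos t\<bar> = cosh (Re w)" using re by (metis abs_mult mult.right_neutral abs_of_pos cosh_real_pos)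
    moreover have "1 < cosh (Re w)" using nz cosh_real_ge_1[of "Re w"] cosh_real_one_iff[of "Re w"] by linarith
    ultimately show False using abs_cos_le_one[of t] by linarith
  qed
  then show ?thesis
    using cos_eq_cos_cases[OF t w] re by (auto simp: complex_eq_iff)
qed

lemma gamma_fn_zero_left: "gamma_fn 0 r = fx (r / 2)"
  by (auto simp: fun_eq_iff gamma_fn_def fx_def field_simps power2_eq_square)

text \<open>Since \<open>cosh\<close> is at least 1, the cosine can be absorbed into a multiple of
  it; this makes the hyperbolic secant a majorant of \<open>gamma_fn\<close>.\<close>

lemma gamma_fn_denominator_ge:
  fixes h r x :: real
  assumes "0 < h" "0 < r" "r < pi / h"
  shows "(1 - \<bar>cos (h * r)\<bar>) * cosh (2 * h * x) \<le> cosh (2 * h * x) - cos (h * r)"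
    and "0 < 1 - \<bar>cos (h * r)\<bar>"
proof -
  have "\<bar>cos (h * r)\<bar> * 1 \<le> \<bar>cos (h * r)\<bar> * cosh (2 * h * x)"
    by (intro mult_left_mono) (auto simp: cosh_real_ge_1)
  then show "(1 - \<bar>cos (h * r)\<bar>) * cosh (2 * h * x) \<le> cosh (2 * h * x) - cos (h * r)"
    unfolding left_diff_distrib by linarith
  have "0 < sin (h * r)" using assms by (intro sin_gt_zero) (auto simp: field_simps)
  then have "0 < (sin (h * r))\<^sup>2" by simp
  then have "(cos (h * r))\<^sup>2 < 1" using sin_cos_squared_add[of "h * r"] by linarith
  then show "0 < 1 - \<bar>cos (h * r)\<bar>" by (simp add: abs_square_less_1)
qed

lemma integrable_gamma_fn:
  assumes h: "0 \<le> h" and r: "0 < r" "h \<noteq> 0 \<Longrightarrow> r < pi / h"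
  shows "integrable lborel (gamma_fn h r)"
proof (cases "h = 0")
  case True
  then show ?thesis using has_bochner_integral_fx[of "r / 2"] r
    by (simp add: gamma_fn_zero_left has_bochner_integral_iff)
next
  case False
  then have h: "0 < h" "r < pi / h" using h r by auto
  note d = gamma_fn_denominator_ge[OF h(1) r(1) h(2)]
  define K where "K = 2 * h * \<bar>sin (h * r)\<bar> / (1 - \<bar>cos (h * r)\<bar>)"
  show ?thesis
  proof (rule Bochner_Integration.integrable_bound)
    show "integrable lborel (\<lambda>x. K * (1 / cosh (2 * h * x)))"
      using has_bochner_integral_sech[of "2 * h"] h
      by (intro integrable_mult_right) (auto simp: has_bochner_integral_iff)
    show "AE x in lborel. norm (gamma_fn h r x) \<le> norm (K * (1 / cosh (2 * h * x)))"
    proof (rule AE_I2)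
      fix x
      have "0 < (1 - \<bar>cos (h * r)\<bar>) * cosh (2 * h * x)" using d by simp
      then have "norm (gamma_fn h r x) \<le> 2 * h * \<bar>sin (h * r)\<bar> / ((1 - \<bar>cos (h * r)\<bar>) * cosh (2 * h * x))"
        using h d(1)[of x] unfolding gamma_fn_def by (auto simp: abs_mult intro!: divide_left_mono mult_pos_pos)
      also have "\<dots> = K * (1 / cosh (2 * h * x))" by (simp add: K_def)
      finally show "norm (gamma_fn h r x) \<le> norm (K * (1 / cosh (2 * h * x)))"
        by (metis abs_ge_self order_trans real_norm_def)
    qed
    show "gamma_fn h r \<in> borel_measurable lborel"
      unfolding gamma_fn_def cosh_field_def by measurable
  qed
qed

text \<open>The integrand has period \<open>\<i> pi / h\<close> up to the factor \<open>exp (- \<bar>p\<bar> pi / h)\<close>, so a rectangle of that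
  height, enclosing the poles \<open>\<i> r / 2\<close> and \<open>\<i> (pi / h - r / 2)\<close>, determines the integral.\<close>

lemma cos_integral_gamma_fn_pos:
  assumes h: "0 < h" and r: "0 < r" "r < pi / h" and p: "p \<noteq> 0"
  shows "(LINT x|lborel. gamma_fn h r x * cos (p * x)) = 2 * pi * gamma_hat h r p"
proof -
  define q where "q = \<bar>p\<bar>"
  \<comment> \<open>At zero frequency the factor \<open>1 - exp (- q * a)\<close> picked up below
    would vanish and the residues would not determine the integral.\<close>
  have q: "0 < q" using p by (simp add: q_def)
  define a where "a = pi / h"
  define t where "t = h * r"
  have a: "0 < a" "r < a" "h * a = pi" using h r by (auto simp: a_def)
  have t: "0 < t" "t < pi" using h r by (auto simp: t_def field_simps)
  have sint: "0 < sin t" using t by (rule sin_gt_zero)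
  define u where "u z = exp (\<i> * of_real q * z) * of_real (2 * h * sin t)" for z :: complex
  define g where "g z = cosh (of_real (2 * h) * z) - of_real (cos t)" for z :: complex
  define f where "f z = u z / g z" for z
  \<comment> \<open>The rectangle \<open>0 \<le> Im z \<le> a\<close> is enlarged up to the next
    poles \<open>- \<i> * r / 2\<close> and \<open>\<i> * (a + r / 2)\<close>, which lie on the
    boundary of the open strip.\<close>
  define S where "S = {z. - (r / 2) < Im z} \<inter> {z. Im z < a + r / 2}"
  define z1 where "z1 = \<i> * of_real (r / 2)"
  define z2 where "z2 = \<i> * of_real (a - r / 2)"
  have z12: "z1 \<in> S" "z2 \<in> S" "z1 \<noteq> z2" using r a by (auto simp: S_def z1_def z2_def complex_eq_iff)
  have opn: "open S" unfolding S_def by (intro open_Int open_halfspace_Im_gt open_halfspace_Im_lt)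
  have cvx: "convex S" unfolding S_def by (intro convex_Int convex_halfspace_Im_gt convex_halfspace_Im_lt)
  have g0: "z = z1 \<or> z = z2" if z: "z \<in> S" "g z = 0" for z
  proof -
    let ?w = "of_real (2 * h) * z"
    have "2 * h * (- (r / 2)) < 2 * h * Im z" "2 * h * Im z < 2 * h * (a + r / 2)"
      using z h by (intro mult_strict_left_mono; simp add: S_def)+
    then have "- t < Im ?w" "Im ?w < 2 * pi + t" using a by (auto simp: t_def algebra_simps)
    then have "?w = \<i> * of_real t \<or> ?w = \<i> * of_real (2 * pi - t)"
      using z by (intro cosh_eq_cos_strip[OF t]) (auto simp: g_def)
    moreover have "\<i> * of_real t = of_real (2 * h) * z1" "\<i> * of_real (2 * pi - t) = of_real (2 * h) * z2"
      using a by (simp_all add: z1_def z2_def t_def complex_eq_iff algebra_simps)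
    ultimately show ?thesis using h by (metis mult_left_cancel of_real_eq_0_iff mult_eq_0_iff less_irrefl zero_neq_numeral)
  qed
  have uh: "u holomorphic_on S" and gh: "g holomorphic_on S"
    unfolding u_def g_def cosh_field_def by (auto intro!: holomorphic_intros)
  have holo: "f holomorphic_on S - {z1, z2}"
    unfolding f_def using g0 by (auto intro!: holomorphic_intros holomorphic_on_subset[OF uh] holomorphic_on_subset[OF gh])
  have cosh_i: "cosh (\<i> * of_real y) = of_real (cos y)" "sinh (\<i> * of_real y) = \<i> * of_real (sin y)" for y
    by (simp_all add: complex_eq_iff Re_cosh Im_cosh sinh_field_def Re_exp Im_exp)
  have w12: "of_real (2 * h) * z1 = \<i> * of_real t" "of_real (2 * h) * z2 = \<i> * of_real (2 * pi - t)"
    using a by (simp_all add: z1_def z2_def t_def complex_eq_iff algebra_simps)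
  have gd: "(g has_field_derivative of_real (2 * h) * sinh (of_real (2 * h) * z)) (at z)" for z
    unfolding g_def by (auto intro!: derivative_eq_intros)
  have res1: "residue f z1 = of_real (exp (- q * (r / 2))) / \<i>"
  proof -
    have "residue f z1 = u z1 / (of_real (2 * h) * sinh (of_real (2 * h) * z1))"
      unfolding f_def
    proof (rule residue_simple_pole_deriv[OF uh gh opn _ z12(1) gd])
      show "connected S" using cvx by (rule convex_connected)
      show "u z1 \<noteq> 0" using h sint by (simp add: u_def)
      show "g z1 = 0" unfolding g_def w12 cosh_i by simp
      show "of_real (2 * h) * sinh (of_real (2 * h) * z1) \<noteq> 0" unfolding w12 cosh_i using h sint by simp
    qed
    also have "\<dots> = of_real (exp (- q * (r / 2))) / \<i>"
      unfolding w12 cosh_i using h sint by (simp add: u_def z1_def field_simps flip: exp_of_real)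
    finally show ?thesis .
  qed
  have res2: "residue f z2 = - of_real (exp (- q * (a - r / 2))) / \<i>"
  proof -
    \<comment> \<open>The derivative of the denominator has opposite signs at the two poles; hence
      the difference of exponentials, which becomes the \<open>sinh\<close> in the numerator of
      \<open>gamma_hat\<close>.\<close>
    have st: "sin (2 * pi - t) = - sin t" "cos (2 * pi - t) = cos t" by (simp_all add: sin_diff cos_diff)
    have "residue f z2 = u z2 / (of_real (2 * h) * sinh (of_real (2 * h) * z2))"
      unfolding f_def
    proof (rule residue_simple_pole_deriv[OF uh gh opn _ z12(2) gd])
      show "connected S" using cvx by (rule convex_connected)
      show "u z2 \<noteq> 0" using h sint by (simp add: u_def)
      show "g z2 = 0" unfolding g_def w12 cosh_i st by simp
      show "of_real (2 * h) * sinh (of_real (2 * h) * z2) \<noteq> 0" unfolding w12 cosh_i st using h sint by simp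
    qed
    also have "u z2 = of_real (exp (- q * (a - r / 2))) * of_real (2 * h * sin t)"
      by (simp add: u_def z2_def algebra_simps flip: exp_of_real)
    also have "\<dots> / (of_real (2 * h) * sinh (of_real (2 * h) * z2)) = - of_real (exp (- q * (a - r / 2))) / \<i>"
      unfolding w12 cosh_i st using h sint by (simp add: field_simps)
    finally show ?thesis .
  qed
  have real: "f (of_real x) = of_real (gamma_fn h r x) * exp (\<i> * of_real (q * x))" for x
    using h by (simp add: f_def u_def g_def gamma_fn_def t_def mult_ac cosh_field_def flip: of_real_mult exp_of_real)
  have shift: "f (z + \<i> * of_real a) = of_real (exp (- q * a)) * f z" for z
  proof -
    have "of_real (2 * h) * (z + \<i> * of_real a) = of_real (2 * h) * z + \<i> * of_real (2 * pi)"
      using a by (simp add: algebra_simps flip: of_real_mult)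
    then have "cosh (of_real (2 * h) * (z + \<i> * of_real a)) = cosh (of_real (2 * h) * z)"
      unfolding cosh_add by (simp only: cosh_add cosh_i) simp
    moreover have "u (z + \<i> * of_real a) = of_real (exp (- q * a)) * u z"
      by (simp add: u_def algebra_simps flip: exp_of_real exp_add)
    ultimately show ?thesis by (simp add: f_def g_def)
  qed
  have int: "integrable lborel (\<lambda>x. f (of_real x))"
  proof (rule Bochner_Integration.integrable_bound[of _ "gamma_fn h r"])
    show gi: "integrable lborel (gamma_fn h r)" using h r by (intro integrable_gamma_fn) auto
    show "(\<lambda>x. f (of_real x)) \<in> borel_measurable lborel"
      unfolding real using borel_measurable_integrable[OF gi] by measurable
    show "AE x in lborel. norm (f (of_real x)) \<le> norm (gamma_fn h r x)" unfolding real by (simp add: norm_mult)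
  qed
  define c where "c = 2 * pi * (exp (- q * (r / 2)) - exp (- q * (a - r / 2)))"
  define I where "I n = integral {- real n..real n} (\<lambda>x. f (of_real x))" for n
  have bound: "norm (I n * of_real (1 - exp (- q * a)) - of_real c)
       \<le> 2 * a * (2 * h * sin t / (sinh (2 * h * real n) - 1))" if n: "0 < n" "sinh (2 * h * real n) > 1" for n
  proof -
    define B where "B = 2 * h * sin t / (sinh (2 * h * real n) - 1)"
    have fB: "norm (f z) \<le> B" if z: "\<bar>Re z\<bar> = real n" "0 \<le> Im z" for z
    proof -
      have "sinh (2 * h * real n) - 1 \<le> norm (cosh (of_real (2 * h) * z)) - norm (of_real (cos t) :: complex)"
      proof -
        have "sinh (2 * h * real n) \<le> norm (cosh (of_real (2 * h) * z))"
          using abs_sinh_Re_le_norm_cosh[of "of_real (2 * h) * z"] z h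
          by (simp add: abs_mult flip: sinh_real_abs)
        moreover have "norm (of_real (cos t) :: complex) \<le> 1" by simp
        ultimately show ?thesis by linarith
      qed
      also have "\<dots> \<le> norm (g z)" unfolding g_def by (rule norm_triangle_ineq2)
      finally have "sinh (2 * h * real n) - 1 \<le> norm (g z)" .
      moreover have "norm (exp (\<i> * of_real q * z)) \<le> 1" using q z by simp
      ultimately show ?thesis
        unfolding f_def B_def norm_divide u_def norm_mult using h sint n
        by (intro frac_le) (auto simp: norm_mult intro!: mult_left_le_one_le)
    qed
    have "norm (integral {- real n..real n} (\<lambda>x. f (of_real x))
         - integral {- real n..real n} (\<lambda>x. f (of_real x + \<i> * of_real a))
           - 2 * of_real pi * \<i> * (\<Sum>w\<in>{z1, z2}. residue f w)) \<le> 2 * a * B"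
    proof (rule rectangle_residue_bound[OF opn cvx _ holo])
      show "cbox (Complex (- real n) 0) (Complex (real n) a) \<subseteq> S"
        using r by (auto simp: S_def in_cbox_complex_iff)
      show "{z1, z2} \<subseteq> box (Complex (- real n) 0) (Complex (real n) a)"
        using a n r by (auto simp: in_box_complex_iff z1_def z2_def)
      show "norm (f (Complex (real n) y)) \<le> B" "norm (f (Complex (- real n) y)) \<le> B" if "0 \<le> y" "y \<le> a" for y
        using that by (auto intro!: fB)
    qed (use a n in auto)
    moreover have "2 * of_real pi * \<i> * (\<Sum>w\<in>{z1, z2}. residue f w) = of_real c"
    proof -
      have "(\<Sum>w\<in>{z1, z2}. residue f w) = residue f z1 + residue f z2" using z12(3) by simp
      also have "\<dots> = of_real (exp (- q * (r / 2)) - exp (- q * (a - r / 2))) / \<i>"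
        unfolding res1 res2 of_real_diff diff_divide_distrib by simp
      finally show ?thesis by (simp only: two_pi_i_mult_divide_i c_def)
    qed
    moreover have "integral {- real n..real n} (\<lambda>x. f (of_real x + \<i> * of_real a)) = of_real (exp (- q * a)) * I n"
      unfolding shift I_def by simp
    ultimately show ?thesis by (simp add: I_def B_def algebra_simps)
  qed
  have "(\<lambda>n. I n * of_real (1 - exp (- q * a)) - of_real c) \<longlonglongrightarrow> 0"
  proof (rule Lim_null_comparison)
    have "eventually (\<lambda>n. 1 < sinh (2 * h * real n)) sequentially" using h by real_asymp
    then show "\<forall>\<^sub>F n in sequentially. norm (I n * of_real (1 - exp (- q * a)) - of_real c)
       \<le> 2 * a * (2 * h * sin t / (sinh (2 * h * real n) - 1))"
      using eventually_gt_at_top[of 0] by eventually_elim (rule bound)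
    show "(\<lambda>n. 2 * a * (2 * h * sin t / (sinh (2 * h * real n) - 1))) \<longlonglongrightarrow> 0" using h by real_asymp
  qed
  moreover have "(\<lambda>n. I n * of_real (1 - exp (- q * a)) - of_real c)
       \<longlonglongrightarrow> (LINT x|lborel. f (of_real x)) * of_real (1 - exp (- q * a)) - of_real c"
    unfolding I_def by (intro tendsto_intros integral_symmetric_interval_tendsto int)
  ultimately have "(LINT x|lborel. f (of_real x)) * of_real (1 - exp (- q * a)) - of_real c = 0"
    using LIMSEQ_unique by blast
  then have "Re ((LINT x|lborel. f (of_real x)) * of_real (1 - exp (- q * a))) = Re (of_real c)" by simp
  then have "Re (LINT x|lborel. f (of_real x)) * (1 - exp (- q * a)) = c" by simp
  moreover have "Re (LINT x|lborel. f (of_real x)) = (LINT x|lborel. Re (f (of_real x)))"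
    by (rule integral_Re[OF int, symmetric])
  moreover have "Re (f (of_real x)) = gamma_fn h r x * cos (p * x)" for x
    unfolding real by (cases "0 \<le> p") (simp_all add: q_def Re_exp)
  ultimately have main: "(LINT x|lborel. gamma_fn h r x * cos (p * x)) * (1 - exp (- q * a)) = c" by simp
  have "gamma_hat h r p = sinh (q / 2 * (a - r)) / sinh (q / 2 * a)"
  proof (cases "0 < p")
    case True
    then show ?thesis using h p by (simp add: gamma_hat_def q_def a_def)
  next
    case False
    then have "p = - q" using p by (simp add: q_def)
    then show ?thesis using h q by (simp add: gamma_hat_def a_def)
  qed
  also have "\<dots> = (c / (2 * pi)) / (1 - exp (- q * a))"
  proof -
    \<comment> \<open>Numerator and denominator share the factor \<open>exp (- q * a / 2)\<close>;
      what remains is the quotient of hyperbolic sines.\<close>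
    have "c / (2 * pi) = exp (- (q / 2 * a)) * (2 * sinh (q / 2 * (a - r)))"
      by (simp add: c_def sinh_field_def algebra_simps flip: exp_add) (simp add: field_simps)
    moreover have "1 - exp (- q * a) = exp (- (q / 2 * a)) * (2 * sinh (q / 2 * a))"
      by (simp add: sinh_field_def algebra_simps flip: exp_add)
    ultimately show ?thesis by simp
  qed
  finally have "gamma_hat h r p = (c / (2 * pi)) / (1 - exp (- q * a))" .
  moreover have "(LINT x|lborel. gamma_fn h r x * cos (p * x)) = c / (1 - exp (- q * a))"
    using main q a by (subst nonzero_eq_divide_eq) auto
  ultimately show ?thesis by simp
qed

lemma cos_integral_gamma_fn:
  assumes h: "0 \<le> h" and r: "0 < r" "h \<noteq> 0 \<Longrightarrow> r < pi / h" and p: "p \<noteq> 0"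
  shows "(LINT x|lborel. gamma_fn h r x * cos (p * x)) = 2 * pi * gamma_hat h r p"
proof (cases "h = 0")
  case True
  then show ?thesis using cos_integral_fx[of "r / 2" p] r by (simp add: gamma_fn_zero_left gamma_hat_def)
next
  case False
  then show ?thesis using assms by (intro cos_integral_gamma_fn_pos) auto
qed

section \<open>Parseval for even functions\<close>

lemma integral_odd_zero:
  fixes f :: "real \<Rightarrow> real"
  assumes "\<And>x. f (- x) = - f x"
  shows "(LINT x|lborel. f x) = 0"
  using lborel_integral_real_affine[of "-1" f 0] assms by simp

text \<open>Insert the cosine integral of \<open>g\<close>, exchange the integrals by Fubini
  (\<open>f x * gh p\<close> is an integrable majorant), and split \<open>cos (p * (x - l))\<close>:
  the sine part drops out because \<open>f\<close> is even. The value of \<open>fh\<close> at 0 does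
  not affect the integral.\<close>

lemma cos_transform_convolution:
  fixes f g fh gh :: "real \<Rightarrow> real"
  assumes f: "integrable lborel f" and even: "\<And>x. f (- x) = f x"
    and fh: "\<And>p. p \<noteq> 0 \<Longrightarrow> (LINT x|lborel. f x * cos (p * x)) = 2 * pi * fh p"
    and fhm [measurable]: "fh \<in> borel_measurable borel"
    and gh: "integrable lborel gh" and g: "\<And>x. g x = (LINT p|lborel. cos (p * x) * gh p)"
  shows "has_bochner_integral lborel (\<lambda>x. f x * g (x - l)) (2 * pi * (LINT p|lborel. gh p * fh p * cos (p * l)))"
proof -
  have [measurable]: "f \<in> borel_measurable borel" "gh \<in> borel_measurable borel"
    using f gh by auto
  define K where "K x p = f x * (cos (p * (x - l)) * gh p)" for x p
  have prod: "integrable (lborel \<Otimes>\<^sub>M lborel) (\<lambda>(x, p). f x * gh p)"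
    by (rule lborel_pair.Fubini_integrable) (use f gh in \<open>auto simp: abs_mult\<close>)
  have K: "integrable (lborel \<Otimes>\<^sub>M lborel) (\<lambda>(x, p). K x p)"
  proof (rule Bochner_Integration.integrable_bound[OF prod])
    have "\<bar>f x\<bar> * (\<bar>cos (p * (x - l))\<bar> * \<bar>gh p\<bar>) \<le> \<bar>f x\<bar> * (1 * \<bar>gh p\<bar>)" for x p
      by (intro mult_left_mono mult_right_mono) auto
    then show "AE z in lborel \<Otimes>\<^sub>M lborel. norm (case z of (x, p) \<Rightarrow> K x p) \<le> norm (case z of (x, p) \<Rightarrow> f x * gh p)"
      by (auto simp: K_def abs_mult)
    show "(\<lambda>(x, p). K x p) \<in> borel_measurable (lborel \<Otimes>\<^sub>M lborel)"
      unfolding K_def by measurable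
  qed
  have inner_p: "(LINT p|lborel. K x p) = f x * g (x - l)" for x
    by (simp add: K_def g)
  have bdd: "integrable lborel (\<lambda>x. f x * cos (p * x))" "integrable lborel (\<lambda>x. f x * sin (p * x))" for p
    by (auto intro!: Bochner_Integration.integrable_bound[OF f] simp: abs_mult mult_left_le)
  have inner_x: "(LINT x|lborel. K x p) = 2 * pi * (gh p * fh p * cos (p * l))" if "p \<noteq> 0" for p
  proof -
    have "K x p = gh p * (cos (p * l) * (f x * cos (p * x)) + sin (p * l) * (f x * sin (p * x)))" for x
      by (simp add: K_def right_diff_distrib cos_diff algebra_simps)
    then have "(LINT x|lborel. K x p) = gh p * (cos (p * l) * (LINT x|lborel. f x * cos (p * x))
        + sin (p * l) * (LINT x|lborel. f x * sin (p * x)))"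
      using bdd by simp
    moreover have "(LINT x|lborel. f x * sin (p * x)) = 0" by (rule integral_odd_zero) (simp add: even)
    ultimately show ?thesis using fh[OF that] by simp
  qed
  have ae: "AE p in lborel. (LINT x|lborel. K x p) = 2 * pi * (gh p * fh p * cos (p * l))"
    using AE_lborel_singleton[of "0::real"] by eventually_elim (rule inner_x)
  have "integrable lborel (\<lambda>x. LINT p|lborel. K x p)" by (rule lborel_pair.integrable_fst[OF K])
  moreover have "(LINT x|lborel. LINT p|lborel. K x p) = (LINT p|lborel. LINT x|lborel. K x p)"
    using lborel_pair.Fubini_integral[OF K] by simp
  moreover have "(LINT p|lborel. LINT x|lborel. K x p) = (LINT p|lborel. 2 * pi * (gh p * fh p * cos (p * l)))"
    by (rule integral_cong_AE[OF _ _ ae]) (auto simp: K_def)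
  ultimately show ?thesis
    by (simp add: has_bochner_integral_iff inner_p)
qed

section \<open>Bounds for the transforms, and the cosine integral for \<open>kappa\<close>\<close>

lemma gamma_hat_abs: "gamma_hat h r \<bar>p\<bar> = gamma_hat h r p"
proof (cases "0 \<le> p")
  case False
  have "sinh (\<bar>p\<bar> / 2 * (pi / h - r)) = - sinh (p / 2 * (pi / h - r))"
    "sinh (\<bar>p\<bar> * pi / (2 * h)) = - sinh (p * pi / (2 * h))"
    using False by (simp_all flip: sinh_minus)
  then show ?thesis unfolding gamma_hat_def by simp
qed simp

lemma gamma_hat_bounds:
  assumes h: "0 \<le> h" and r: "0 \<le> r" "h \<noteq> 0 \<Longrightarrow> r \<le> pi / h"
  shows "0 \<le> gamma_hat h r p \<and> gamma_hat h r p \<le> 1"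
proof (cases "h = 0 \<or> p = 0")
  case True
  then show ?thesis using r h by (auto simp: gamma_hat_def field_simps)
next
  case False
  then have h: "0 < h" "r \<le> pi / h" and q: "0 < \<bar>p\<bar>" using h r by auto
  have "gamma_hat h r \<bar>p\<bar> = sinh (\<bar>p\<bar> / 2 * (pi / h - r)) / sinh (\<bar>p\<bar> / 2 * (pi / h))"
    using h q by (simp add: gamma_hat_def)
  moreover have "0 \<le> \<bar>p\<bar> / 2 * (pi / h - r)" "\<bar>p\<bar> / 2 * (pi / h - r) \<le> \<bar>p\<bar> / 2 * (pi / h)"
    using h q r by (simp, intro mult_left_mono) auto
  moreover have "0 < sinh (\<bar>p\<bar> / 2 * (pi / h))" using h q by simp
  ultimately show ?thesis unfolding gamma_hat_abs by (simp add: divide_le_eq)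
qed

lemma borel_measurable_gamma_hat [measurable]: "gamma_hat h r \<in> borel_measurable borel"
  unfolding gamma_hat_def sinh_field_def by measurable

lemma borel_measurable_kappa_hat [measurable]: "kappa_hat h r \<in> borel_measurable borel"
  unfolding kappa_hat_def cosh_field_def by measurable

lemma integrable_sech_half: "integrable lborel (\<lambda>p::real. 1 / (2 * cosh (p / 2)))"
proof -
  have "integrable lborel (\<lambda>p::real. 1 / 2 * (1 / cosh (1 / 2 * p)))"
    using has_bochner_integral_sech[of "1 / 2"] by (intro integrable_mult_right) (simp add: has_bochner_integral_iff)
  then show ?thesis by simp
qed

lemma integrable_kappa_hat:
  assumes h: "0 \<le> h" and r: "0 \<le> r" "h \<noteq> 0 \<Longrightarrow> r \<le> pi / h"
  shows "integrable lborel (kappa_hat h r)"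
proof (rule Bochner_Integration.integrable_bound[OF integrable_sech_half])
  show "AE p in lborel. norm (kappa_hat h r p) \<le> norm (1 / (2 * cosh (p / 2)) :: real)"
    using gamma_hat_bounds[OF assms] by (auto simp: kappa_hat_def intro!: divide_right_mono)
qed simp

lemma kappa_eq_lebesgue_integral:
  assumes "0 \<le> h" "0 \<le> r" "h \<noteq> 0 \<Longrightarrow> r \<le> pi / h"
  shows "kappa h r x = (LINT p|lborel. cos (p * x) * kappa_hat h r p)"
proof -
  have "integrable lborel (\<lambda>p. cos (p * x) * kappa_hat h r p)"
    by (rule Bochner_Integration.integrable_bound[OF integrable_kappa_hat[OF assms]])
      (auto simp: abs_mult mult_left_le_one_le)
  then show ?thesis unfolding kappa_def by (rule integral_lborel)
qed

lemma cos_integral_sech: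
  "(LINT p|lborel. cos (p * l) / (2 * cosh (p / 2))) = pi / cosh (pi * l)"
proof (cases "l = 0")
  \<comment> \<open>Here \<open>l\<close> is the frequency, and the transform of
    \<open>gamma_fn\<close> is available at nonzero frequencies only.\<close>
  case True
  have "(LINT p|lborel. 1 / 2 * (1 / cosh (1 / 2 * p))) = 1 / 2 * (LINT p|lborel. 1 / cosh (1 / 2 * p :: real))"
    by (rule integral_mult_right_zero)
  also have "(LINT p|lborel. 1 / cosh (1 / 2 * p)) = pi / (1 / 2)"
    by (rule has_bochner_integral_integral_eq[OF has_bochner_integral_sech]) simp
  finally show ?thesis using True by simp
next
  case False
  \<comment> \<open>\<open>gamma_fn (1/4) (2 pi)\<close> is the hyperbolic secant, and so is its transform.\<close>
  have "(LINT p|lborel. gamma_fn (1/4) (2 * pi) p * cos (l * p)) = 2 * pi * gamma_hat (1/4) (2 * pi) l"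
    using False by (intro cos_integral_gamma_fn) auto
  \<comment> \<open>The product of the two parameters is \<open>pi / 2\<close>, so the cosine in the
    denominator vanishes and the sine is 1.\<close>
  moreover have "gamma_fn (1/4) (2 * pi) p = 1 / (2 * cosh (p / 2))" for p
    by (simp add: gamma_fn_def)
  moreover have "gamma_hat (1/4) (2 * pi) l = sinh (pi * l) / sinh (2 * (pi * l))"
    using False by (simp add: gamma_hat_def algebra_simps)
  moreover have "sinh (pi * l) / sinh (2 * (pi * l)) = 1 / (2 * cosh (pi * l))"
    using False by (simp add: sinh_double)
  ultimately show ?thesis by (simp add: mult.commute)
qed

section \<open>The transform of \<open>Psi\<close>\<close>

text \<open>The parameters of \<open>fx\<close> that survive the cancellation in \<open>Psi\<close>:
  they start at \<open>(\<bar>M - P\<bar> + 1) / 2\<close> and increase by 1. This form is symmetric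
  in \<open>M\<close> and \<open>P\<close>.\<close>

definition Psi_index :: "nat \<Rightarrow> nat \<Rightarrow> nat \<Rightarrow> real" where
  "Psi_index M P k = real k + (real (max M P) - real (min M P) + 1) / 2"

definition Psi_hat :: "nat \<Rightarrow> nat \<Rightarrow> real \<Rightarrow> real" where
  "Psi_hat M P p = (\<Sum>k<min M P. exp (- Psi_index M P k * \<bar>p\<bar>))"

lemma sum_lessThan_add:
  fixes u :: "nat \<Rightarrow> 'a::comm_monoid_add"
  shows "(\<Sum>k<n + m. u k) = (\<Sum>k<n. u k) + (\<Sum>k<m. u (n + k))"
  by (induction m) (simp_all add: add.assoc)

lemma fx_minus: "fx (- a) x = - fx a x"
  by (simp add: fx_def)

lemma fx_even: "fx a (- x) = fx a x"
  by (simp add: fx_def)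

text \<open>For \<open>M > P\<close> the indices of \<open>Psi\<close> start with a block symmetric about \<open>0\<close>, on which the odd function
  \<open>a \<mapsto> fx a x\<close> sums to zero; only positive indices are left.\<close>

lemma Psi_eq_sum_pos:
  "Psi M P x = (\<Sum>k<min M P. fx (Psi_index M P k) x)"
proof (cases "M \<le> P")
  case True
  then show ?thesis unfolding Psi_def by (intro sum.cong) (auto simp: Psi_index_def min_def max_def field_simps)
next
  case False
  then obtain N where M: "M = N + P" by (metis add.commute le_add_diff_inverse linear)
  define u where "u k = fx (real k - real M / 2 + 1 / 2 + real P / 2) x" for k
  \<comment> \<open>The parameters at \<open>k\<close> and \<open>N - 1 - k\<close> are opposite.
    For odd \<open>N\<close> the middle one is 0, where \<open>fx\<close> is 0.\<close>
  have "u (N - Suc k) = - u k" if "k < N" for k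
  proof -
    have "real (N - Suc k) - real M / 2 + 1 / 2 + real P / 2 = - (real k - real M / 2 + 1 / 2 + real P / 2)"
      using that by (simp add: M field_simps of_nat_diff)
    then show ?thesis unfolding u_def by (simp only: fx_minus)
  qed
  then have "(\<Sum>k<N. u (N - Suc k)) = - (\<Sum>k<N. u k)" by (simp add: sum_negf)
  then have "(\<Sum>k<N. u k) = 0" using sum.nat_diff_reindex[of u N] by linarith
  then have "Psi M P x = (\<Sum>k<P. u (N + k))"
    using sum_lessThan_add[of u N P] by (simp add: Psi_def u_def M)
  also have "\<dots> = (\<Sum>k<min M P. fx (Psi_index M P k) x)"
  proof (rule sum.cong)
    fix k
    have "real (N + k) - real M / 2 + 1 / 2 + real P / 2 = Psi_index M P k"
      unfolding Psi_index_def M by (simp add: max_def min_def add_divide_distrib diff_divide_distrib)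
    then show "u (N + k) = fx (Psi_index M P k) x" unfolding u_def by (simp only:)
  qed (simp add: M)
  finally show ?thesis .
qed

lemma Psi_index_pos: "0 < Psi_index M P k"
  by (simp add: Psi_index_def max_def min_def add_nonneg_pos)

lemma Psi_even: "Psi M P (- x) = Psi M P x"
  by (simp add: Psi_def fx_even)

lemma integrable_fx: "0 < a \<Longrightarrow> integrable lborel (fx a)"
  using has_bochner_integral_fx by (simp add: has_bochner_integral_iff)

lemma integrable_Psi: "integrable lborel (Psi M P)"
  unfolding Psi_eq_sum_pos by (intro Bochner_Integration.integrable_sum integrable_fx Psi_index_pos)

lemma integrable_Psi_hat: "integrable lborel (Psi_hat M P)"
  unfolding Psi_hat_def by (intro Bochner_Integration.integrable_sum integrable_exp_minus_abs Psi_index_pos)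

lemma integrable_mult_cos:
  fixes f :: "real \<Rightarrow> real"
  assumes f: "integrable lborel f"
  shows "integrable lborel (\<lambda>x. f x * cos (x * l))"
  using borel_measurable_integrable[OF f]
  by (intro Bochner_Integration.integrable_bound[OF f]) (auto simp: abs_mult mult_left_le)

lemma cos_integral_Psi: "(LINT x|lborel. Psi M P x * cos (p * x)) = 2 * pi * Psi_hat M P p"
proof -
  have "(LINT x|lborel. (\<Sum>k<min M P. fx (Psi_index M P k) x * cos (p * x)))
      = (\<Sum>k<min M P. LINT x|lborel. fx (Psi_index M P k) x * cos (p * x))"
    using integrable_mult_cos[OF integrable_fx[OF Psi_index_pos], of M P _ p]
    by (intro Bochner_Integration.integral_sum) (simp add: mult.commute)
  then show ?thesis
    by (simp add: Psi_eq_sum_pos Psi_hat_def sum_distrib_right sum_distrib_left cos_integral_fx Psi_index_pos)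
qed

text \<open>The counterpart of \<open>cos_integral_Psi\<close>: that form serves pairings with
  \<open>kappa\<close>, this one pairings with \<open>gamma_fn\<close> and the bare
  energies.\<close>

lemma Psi_eq_cos_integral: "Psi M P x = (LINT p|lborel. cos (p * x) * Psi_hat M P p)"
proof -
  have "(LINT p|lborel. (\<Sum>k<min M P. cos (p * x) * exp (- Psi_index M P k * \<bar>p\<bar>)))
      = (\<Sum>k<min M P. LINT p|lborel. cos (p * x) * exp (- Psi_index M P k * \<bar>p\<bar>))"
    using integrable_mult_cos[OF integrable_exp_minus_abs[OF Psi_index_pos], of M P _ x]
    by (intro Bochner_Integration.integral_sum) (simp add: mult.commute)
  also have "\<dots> = Psi M P x"
    unfolding Psi_eq_sum_pos by (intro sum.cong refl fx_eq_cos_integral Psi_index_pos)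
  finally show ?thesis by (simp only: Psi_hat_def sum_distrib_left)
qed

text \<open>The boundary condition at spin 0: it allows the left end of the first gap to be treated
  as a site that contributes nothing.\<close>

lemma Psi_hat_zero: "Psi_hat 0 P p = 0"
  by (simp add: Psi_hat_def)

section \<open>Closed form of \<open>Psi_hat\<close> and its Green's function identities\<close>

lemma sum_exp_telescope:
  "(\<Sum>k<n. exp (- (real k + c) * (2 * t))) * (2 * sinh t) = exp (- ((2 * c - 1) * t)) - exp (- ((2 * c - 1 + 2 * real n) * t))"
proof (induction n)
  case (Suc n)
  have "exp (- (real n + c) * (2 * t)) * (2 * sinh t)
      = exp (- ((2 * c - 1 + 2 * real n) * t)) - exp (- ((2 * c - 1 + 2 * real (Suc n)) * t))"
  proof -
    have "exp (- (real n + c) * (2 * t)) * (2 * sinh t)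
        = exp (- (real n + c) * (2 * t)) * exp t - exp (- (real n + c) * (2 * t)) * exp (- t)"
      by (simp add: sinh_field_def right_diff_distrib)
    also have "\<dots> = exp (- (real n + c) * (2 * t) + t) - exp (- (real n + c) * (2 * t) + - t)"
      by (simp only: exp_add)
    also have "- (real n + c) * (2 * t) + t = - ((2 * c - 1 + 2 * real n) * t)" by (simp add: algebra_simps)
    also have "- (real n + c) * (2 * t) + - t = - ((2 * c - 1 + 2 * real (Suc n)) * t)" by (simp add: algebra_simps)
    finally show ?thesis .
  qed
  then show ?case using Suc by (simp add: distrib_right)
qed simp

text \<open>Summing the geometric series gives the usual shape of a Green's function: the solution
  vanishing at 0, taken at the smaller argument, times the decaying solution at the larger one. The
  product form also covers \<open>p = 0\<close>.\<close>

lemma Psi_hat_mult_sinh: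
  "Psi_hat M P p * sinh (\<bar>p\<bar> / 2) = exp (- real (max M P) * (\<bar>p\<bar> / 2)) * sinh (real (min M P) * (\<bar>p\<bar> / 2))"
proof -
  define m X t where "m = min M P" "X = max M P" "t = \<bar>p\<bar> / 2"
  have "Psi_hat M P p = (\<Sum>k<m. exp (- (real k + (real X - real m + 1) / 2) * (2 * t)))"
    by (simp add: Psi_hat_def Psi_index_def m_X_t_def)
  then have "Psi_hat M P p * (2 * sinh t) = exp (- ((2 * ((real X - real m + 1) / 2) - 1) * t))
      - exp (- ((2 * ((real X - real m + 1) / 2) - 1 + 2 * real m) * t))"
    by (simp only: sum_exp_telescope)
  also have "- ((2 * ((real X - real m + 1) / 2) - 1) * t) = - real X * t + real m * t"
    by (simp add: field_simps)
  also have "- ((2 * ((real X - real m + 1) / 2) - 1 + 2 * real m) * t) = - real X * t + - (real m * t)"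
    by (simp add: field_simps)
  also have "exp (- real X * t + real m * t) - exp (- real X * t + - (real m * t)) = exp (- real X * t) * (2 * sinh (real m * t))"
    by (simp only: exp_add) (simp add: sinh_field_def right_diff_distrib)
  finally show ?thesis by (simp add: m_X_t_def)
qed

text \<open>As functions of \<open>m\<close> both sides solve \<open>f'' = t^2 * f\<close>, and they
  agree at \<open>m = n\<close> and \<open>m = b\<close>. The same holds with any solution in place
  of the exponential; the next lemma takes the one vanishing at 0.\<close>

lemma sinh_interpolation_exp:
  fixes n m b t :: real
  shows "sinh ((b - m) * t) * exp (- n * t) + sinh ((m - n) * t) * exp (- b * t) = sinh ((b - n) * t) * exp (- m * t)"
  by (simp add: sinh_field_def left_diff_distrib exp_diff exp_minus field_simps)

lemma sinh_interpolation_sinh: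
  fixes n m b t :: real
  shows "sinh ((b - m) * t) * sinh (n * t) + sinh ((m - n) * t) * sinh (b * t) = sinh ((b - n) * t) * sinh (m * t)"
  by (simp add: sinh_field_def left_diff_distrib exp_diff exp_minus field_simps)

text \<open>As a function of the spin \<open>M\<close>, \<open>Psi_hat M P p\<close> is a linear combination of \<open>exp (M \<bar>p\<bar> / 2)\<close> and
  \<open>exp (- M \<bar>p\<bar> / 2)\<close> on either side of \<open>M = P\<close>, and \<open>gamma_hat\<close> is the corresponding interpolation
  kernel on an interval.\<close>

lemma Psi_hat_interpolation:
  fixes n m b P :: nat
  assumes nmb: "n < b" "n \<le> m" "m \<le> b" and P: "P \<le> n \<or> b \<le> P" and p: "p \<noteq> 0"
    and h: "h = pi / (real b - real n)"
  shows "gamma_hat h (real m - real n) p * Psi_hat n P p + gamma_hat h (real b - real m) p * Psi_hat b P p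
      = Psi_hat m P p"
proof -
  define t where "t = \<bar>p\<bar> / 2"
  have t: "0 < t" using p by (simp add: t_def)
  define G where "G k = exp (- real (max k P) * t) * sinh (real (min k P) * t)" for k
  have G: "Psi_hat k P p = G k / sinh t" for k
    using Psi_hat_mult_sinh[of k P p] t by (simp add: G_def t_def field_simps)
  have gh: "gamma_hat h r p = sinh ((real b - real n - r) * t) / sinh ((real b - real n) * t)" for r
  proof -
    have "gamma_hat h r \<bar>p\<bar> = sinh ((real b - real n - r) * t) / sinh ((real b - real n) * t)"
      using nmb p by (simp add: gamma_hat_def h t_def mult.commute)
    then show ?thesis by (simp only: gamma_hat_abs)
  qed
  have nz: "0 < sinh ((real b - real n) * t)" "0 < sinh t" using nmb t by simp_all
  \<comment> \<open>As \<open>P\<close> is not strictly between \<open>n\<close> and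
    \<open>b\<close>, the three arguments lie on the same side of the kink, and one branch of
    \<open>G\<close> applies to all of them.\<close>
  have "sinh ((real b - real m) * t) * G n + sinh ((real m - real n) * t) * G b = sinh ((real b - real n) * t) * G m"
  proof (cases "P \<le> n")
    case True
    then have "G k = exp (- real k * t) * sinh (real P * t)" if "n \<le> k" for k
      using order_trans[OF True that] by (simp add: G_def max_absorb1 min_absorb2)
    then show ?thesis using nmb sinh_interpolation_exp[of "real b" "real m" t "real n"]
      by (simp add: mult.assoc[symmetric] distrib_right[symmetric])
  next
    case False
    then have "G k = exp (- real P * t) * sinh (real k * t)" if "k \<le> b" for k
      using order_trans[OF that, of P] False P by (simp add: G_def max_absorb2 min_absorb1)
    then show ?thesis using nmb sinh_interpolation_sinh[of "real b" "real m" t "real n"]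
      by (simp add: mult.left_commute distrib_left[symmetric])
  qed
  then have "(sinh ((real b - real m) * t) * G n + sinh ((real m - real n) * t) * G b) / (sinh ((real b - real n) * t) * sinh t)
      = G m / sinh t"
    using nz nmb by simp
  then show ?thesis
    unfolding G gh by (simp add: add_divide_distrib)
qed

text \<open>The unbounded last gap: beyond the kink \<open>Psi_hat\<close> is a pure decaying
  exponential in the spin, so the left end alone determines it.\<close>

lemma Psi_hat_outer:
  assumes "P \<le> n" "n \<le> m" and p: "p \<noteq> 0"
  shows "gamma_hat 0 (real m - real n) p * Psi_hat n P p = Psi_hat m P p"
proof -
  define t where "t = \<bar>p\<bar> / 2"
  have t: "0 < sinh t" using p by (simp add: t_def)
  have "gamma_hat 0 (real m - real n) p * exp (- real n * t) = exp (- real m * t)"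
    by (simp add: gamma_hat_def t_def field_simps flip: exp_add)
  then have "gamma_hat 0 (real m - real n) p * (Psi_hat n P p * sinh t) = Psi_hat m P p * sinh t"
    unfolding t_def Psi_hat_mult_sinh using assms by (simp add: max_absorb1 min_absorb2 mult.assoc[symmetric])
  then show ?thesis using t by simp
qed

text \<open>\<open>Psi_hat\<close> is a Green's function for the discrete operator
  \<open>F \<mapsto> (F (n + 1) + F (n - 1)) / (2 cosh (p / 2)) - F n\<close>.\<close>

lemma Psi_hat_defect:
  assumes n: "1 \<le> n" and P: "1 \<le> P" and p: "p \<noteq> 0"
  shows "(Psi_hat (n + 1) P p + Psi_hat (n - 1) P p) / (2 * cosh (p / 2)) - Psi_hat n P p
      = - (if n = P then 1 / (2 * cosh (p / 2)) else 0)"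
proof -
  define t where "t = \<bar>p\<bar> / 2"
  have t: "0 < sinh t" using p by (simp add: t_def)
  have ch: "cosh (p / 2) = cosh t" using cosh_real_abs[of "p / 2"] by (simp add: t_def)
  define G where "G k = exp (- real (max k P) * t) * sinh (real (min k P) * t)" for k
  have G: "Psi_hat k P p = G k / sinh t" for k
    using Psi_hat_mult_sinh[of k P p] t by (simp add: G_def t_def field_simps)
  have r: "real (n - Suc 0) = real n - 1" using n by simp
  \<comment> \<open>For \<open>n \<noteq> P\<close> the three values come from one branch and the
    addition theorems give 0. For \<open>n = P\<close> the neighbours lie on different branches, and
    the mismatch is \<open>- sinh t\<close>.\<close>
  have *: "G (n + 1) + G (n - 1) - 2 * cosh t * G n = - (if n = P then sinh t else 0)"
  proof -
    consider "n < P" | "n = P" | "P < n" by linarith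
    then show ?thesis
    proof cases
      case 1
      then have "G (n + 1) = exp (- real P * t) * sinh ((real n + 1) * t)"
        "G (n - 1) = exp (- real P * t) * sinh ((real n - 1) * t)" "G n = exp (- real P * t) * sinh (real n * t)"
        by (auto simp: G_def max_def min_def r)
      then show ?thesis using 1
        by (simp add: left_diff_distrib distrib_right sinh_add sinh_diff algebra_simps)
    next
      case 2
      then have "G (n + 1) = exp (- (real n + 1) * t) * sinh (real n * t)"
        "G (n - 1) = exp (- real n * t) * sinh ((real n - 1) * t)" "G n = exp (- real n * t) * sinh (real n * t)"
        using r by (auto simp: G_def max_def min_def)
      moreover have "exp (- (real n + 1) * t) * sinh (real n * t) + exp (- real n * t) * sinh ((real n - 1) * t)
          - 2 * cosh t * (exp (- real n * t) * sinh (real n * t)) = - sinh t"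
        by (simp add: sinh_field_def cosh_field_def distrib_right left_diff_distrib exp_diff exp_add exp_minus field_simps)
      ultimately show ?thesis using 2 by simp
    next
      case 3
      then have "max (n - 1) P = n - 1" "min (n - 1) P = P" "real (n - 1) = real n - 1" by auto
      then have "G (n - 1) = exp (- (real n - 1) * t) * sinh (real P * t)" by (simp only: G_def)
      moreover have "G (n + 1) = exp (- (real n + 1) * t) * sinh (real P * t)" "G n = exp (- real n * t) * sinh (real P * t)"
        using 3 by (auto simp: G_def max_def min_def)
      moreover have "exp (- (real n + 1) * t) + exp (- (real n - 1) * t) = 2 * cosh t * exp (- real n * t)"
        by (simp add: cosh_field_def distrib_right left_diff_distrib exp_diff exp_add exp_minus field_simps)
      ultimately show ?thesis using 3
        by (simp add: mult.assoc[symmetric] distrib_right[symmetric])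
    qed
  qed
  have "(Psi_hat (n + 1) P p + Psi_hat (n - 1) P p) / (2 * cosh (p / 2)) - Psi_hat n P p
      = (G (n + 1) + G (n - 1) - 2 * cosh t * G n) / (sinh t * (2 * cosh t))"
    unfolding G ch using t by (simp add: divide_simps)
  then show ?thesis unfolding * ch using t by simp
qed

text \<open>The Fourier side of \<open>1 / (2 * pi)\<close> times the integral of
  \<open>kappa h r (x - l) * Psi M P x\<close>; the prefactor is the one in \<open>rreg\<close>.
  Likewise \<open>gamma_Psi\<close> below, with the prefactor of \<open>cfun\<close>.\<close>

definition kappa_Psi :: "real \<Rightarrow> real \<Rightarrow> nat \<Rightarrow> nat \<Rightarrow> real \<Rightarrow> real" where
  "kappa_Psi h r M P l = (LINT p|lborel. kappa_hat h r p * Psi_hat M P p * cos (p * l))"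

definition gamma_Psi :: "real \<Rightarrow> real \<Rightarrow> nat \<Rightarrow> nat \<Rightarrow> real \<Rightarrow> real" where
  "gamma_Psi h r M P l = (LINT p|lborel. gamma_hat h r p * Psi_hat M P p * cos (p * l))"

lemma borel_measurable_Psi_hat [measurable]: "Psi_hat M P \<in> borel_measurable borel"
  using integrable_Psi_hat[of M P] by auto

lemma integrable_gamma_hat_Psi_hat:
  assumes "0 \<le> h" "0 \<le> r" "h \<noteq> 0 \<Longrightarrow> r \<le> pi / h"
  shows "integrable lborel (\<lambda>p. gamma_hat h r p * Psi_hat M P p * cos (p * l))"
proof (rule integrable_mult_cos, rule Bochner_Integration.integrable_bound[OF integrable_Psi_hat[of M P]])
  show "AE p in lborel. norm (gamma_hat h r p * Psi_hat M P p) \<le> norm (Psi_hat M P p)"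
    using gamma_hat_bounds[OF assms] by (auto simp: abs_mult intro!: mult_left_le_one_le)
qed simp

lemma integrable_kappa_hat_Psi_hat:
  assumes "0 \<le> h" "0 \<le> r" "h \<noteq> 0 \<Longrightarrow> r \<le> pi / h"
  shows "integrable lborel (\<lambda>p. kappa_hat h r p * Psi_hat M P p * cos (p * l))"
proof (rule integrable_mult_cos, rule Bochner_Integration.integrable_bound[OF integrable_Psi_hat[of M P]])
  have "\<bar>kappa_hat h r p\<bar> \<le> 1" for p
    using gamma_hat_bounds[OF assms, of p] cosh_real_ge_1[of "p / 2"] by (auto simp: kappa_hat_def divide_le_eq)
  then show "AE p in lborel. norm (kappa_hat h r p * Psi_hat M P p) \<le> norm (Psi_hat M P p)"
    by (auto simp: abs_mult intro!: mult_left_le_one_le)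
qed simp

lemma has_bochner_integral_kappa_Psi:
  assumes "0 \<le> h" "0 \<le> r" "h \<noteq> 0 \<Longrightarrow> r \<le> pi / h"
  shows "has_bochner_integral lborel (\<lambda>x. kappa h r (x - l) * Psi M P x) (2 * pi * kappa_Psi h r M P l)"
  using cos_transform_convolution[OF integrable_Psi Psi_even cos_integral_Psi _ integrable_kappa_hat[OF assms]
      kappa_eq_lebesgue_integral[OF assms], of M P l]
  by (simp add: kappa_Psi_def mult_ac)

lemma has_bochner_integral_gamma_Psi:
  assumes h: "0 \<le> h" and r: "0 < r" "h \<noteq> 0 \<Longrightarrow> r < pi / h"
  shows "has_bochner_integral lborel (\<lambda>x. gamma_fn h r (x - l) * Psi M P x) (2 * pi * gamma_Psi h r M P l)"
proof -
  have even: "gamma_fn h r (- x) = gamma_fn h r x" for x by (simp add: gamma_fn_def)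
  \<comment> \<open>The convolution lemma shifts its second factor, here \<open>Psi\<close>; a
    translation of the variable then moves the shift to \<open>gamma_fn\<close>.\<close>
  have "has_bochner_integral lborel (\<lambda>x. gamma_fn h r x * Psi M P (x - (- l))) (2 * pi * gamma_Psi h r M P l)"
    using cos_transform_convolution[OF integrable_gamma_fn[OF assms] even cos_integral_gamma_fn[OF assms] _ integrable_Psi_hat
      Psi_eq_cos_integral, of M P "- l"]
    by (simp add: gamma_Psi_def mult_ac)
  then have "has_bochner_integral lborel (\<lambda>x. gamma_fn h r (- l + 1 * x) * Psi M P (- l + 1 * x - (- l)))
     ((2 * pi * gamma_Psi h r M P l) /\<^sub>R \<bar>1\<bar>)"
    by (subst (asm) lborel_has_bochner_integral_real_affine_iff[where c = 1 and t = "- l"]) auto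
  then show ?thesis by simp
qed

section \<open>The energy of the excitations\<close>

text \<open>\<open>S 0\<close> is arbitrary; this enforces the convention that the spin at index 0
  is 0, while keeping doubled spins as natural numbers.\<close>

definition site :: "(nat \<Rightarrow> nat) \<Rightarrow> nat \<Rightarrow> nat" where
  "site S j = (if j = 0 then 0 else S j)"

lemma sb_eq_site: "sb S j = real (site S j) / 2"
  by (simp add: sb_def site_def)

text \<open>\<open>DeltaE\<close> is summed over the site whose density is perturbed. This lemma and
  the next regroup the contributions to neighbouring densities by the site of the hole that causes
  them.\<close>

lemma sum_shift_down:
  fixes X :: "nat \<Rightarrow> 'a::comm_monoid_add"
  assumes "X 0 = 0"
  shows "(\<Sum>j = 1..L. X (j - 1)) = (\<Sum>j = 1..L. if j < L then X j else 0)"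
proof (cases L)
  case (Suc K)
  have "(\<Sum>j = 1..L. X (j - 1)) = (\<Sum>j = 0..K. X j)"
    unfolding Suc by (rule sum.reindex_bij_witness[of _ Suc "\<lambda>j. j - 1"]) auto
  also have "\<dots> = (\<Sum>j = 1..K. X j)" using assms by (simp add: sum.atLeast_Suc_atMost)
  also have "\<dots> = (\<Sum>j = 1..L. if j < L then X j else 0)"
    unfolding Suc by simp
  finally show ?thesis .
qed simp

lemma sum_shift_up:
  fixes Y :: "nat \<Rightarrow> 'a::comm_monoid_add"
  assumes "Y (Suc L) = 0"
  shows "(\<Sum>j = 1..L. Y (Suc j)) = (\<Sum>j = 1..L. if 2 \<le> j then Y j else 0)"
proof -
  have "(\<Sum>j = 1..L. Y (Suc j)) = (\<Sum>j = 2..Suc L. Y j)"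
    by (rule sum.reindex_bij_witness[of _ "\<lambda>j. j - 1" Suc]) auto
  also have "\<dots> = (\<Sum>j = 2..L. Y j)" using assms by (cases "2 \<le> Suc L") auto
  also have "\<dots> = (\<Sum>j = 1..L. if 2 \<le> j then Y j else 0)"
    by (rule sum.mono_neutral_cong_left) auto
  finally show ?thesis .
qed

text \<open>Regrouping for strings: the right side runs over the gaps \<open>0..L\<close>, each
  acting on the sites at its two ends; the conditions drop the missing right end of gap
  \<open>L\<close> and the left end of gap 0.\<close>

lemma sum_shift_both:
  fixes U V :: "nat \<Rightarrow> 'a::comm_monoid_add"
  shows "(\<Sum>j = 1..L. U (j - 1) + V j) = (\<Sum>j = 0..L. (if j < L then U j else 0) + (if 1 \<le> j then V j else 0))"
proof -
  have "(\<Sum>j = 1..L. U (j - 1)) = (\<Sum>j\<in>{0..<L}. U j)"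
    by (rule sum.reindex_bij_witness[of _ Suc "\<lambda>j. j - 1"]) auto
  also have "\<dots> = (\<Sum>j = 0..L. if j < L then U j else 0)"
    by (rule sum.mono_neutral_cong_left) auto
  finally have "(\<Sum>j = 1..L. U (j - 1)) = (\<Sum>j = 0..L. if j < L then U j else 0)" .
  moreover have "(\<Sum>j = 1..L. V j) = (\<Sum>j = 0..L. if 1 \<le> j then V j else 0)"
    by (rule sum.mono_neutral_cong_left) auto
  ultimately show ?thesis by (simp add: sum.distrib)
qed

text \<open>Spins are doubled as in \<^const>\<open>sb\<close>; \<open>S i\<close> is twice the spin \<open>s\<close> of the Hamiltonian \<open>H\<^sup>(\<^sup>s\<^sup>)\<close>.\<close>

locale spin_chain =
  fixes L :: nat and S :: "nat \<Rightarrow> nat" and i :: nat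
  assumes pos: "\<And>j. 1 \<le> j \<Longrightarrow> j \<le> L \<Longrightarrow> 0 < S j"
    and incr: "\<And>j. 1 \<le> j \<Longrightarrow> j < L \<Longrightarrow> S j < S (Suc j)"
    and i: "1 \<le> i" "i \<le> L"
begin

section \<open>Order of the sites and lengths of the gaps\<close>

lemma site_less_Suc: "j < L \<Longrightarrow> site S j < site S (Suc j)"
  using pos[of "Suc j"] incr[of j] by (cases j) (auto simp: site_def)

lemma site_mono: "j \<le> k \<Longrightarrow> k \<le> L \<Longrightarrow> site S j \<le> site S k"
proof (induction k rule: dec_induct)
  case (step k)
  then show ?case using site_less_Suc[of k] by simp
qed simp

lemma site_strict_mono:
  assumes "j < k" "k \<le> L" shows "site S j < site S k"
  using site_less_Suc[of j] site_mono[of "Suc j" k] assms by simp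

lemma site_pos: "1 \<le> j \<Longrightarrow> site S j = S j"
  by (simp add: site_def)

text \<open>\<open>S i\<close> is itself a site, so the kink of the Green's function never falls
  strictly inside a gap, as interpolation across the gap requires.\<close>

lemma target_outside_gap: "j < L \<Longrightarrow> S i \<le> site S j \<or> site S (Suc j) \<le> S i"
  using site_mono[of i j] site_mono[of "Suc j" i] i by (metis Suc_leI leI less_imp_le_nat site_pos)

lemma hb_eq: "j < L \<Longrightarrow> hb L S j = pi / (real (site S (Suc j)) - real (site S j))"
  unfolding hb_def sb_eq_site by (simp add: right_diff_distrib)

lemma hb_last: "hb L S L = 0"
  by (simp add: hb_def)

lemma hb_nonneg: "0 \<le> hb L S j"
  using site_less_Suc[of j] hb_eq[of j] by (cases "j < L") (auto simp: hb_def)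

lemma hb_gap:
  assumes "hb L S j \<noteq> 0"
  shows "j < L" "pi / hb L S j = real (site S (Suc j)) - real (site S j)"
proof -
  show "j < L" using assms by (auto simp: hb_def split: if_splits)
  then show "pi / hb L S j = real (site S (Suc j)) - real (site S j)" using site_less_Suc[of j] by (simp add: hb_eq)
qed

text \<open>Gap length 1 does occur. Then the indices gap - 1 and 1 of \<open>kappa\<close> are the
  degenerate values \<open>0\<close> and \<open>pi / h\<close>, which the lemmas on
  \<open>kappa\<close> admit; such a gap contains no strings, so \<open>gamma_fn\<close> is never
  degenerate.\<close>

lemma gap_ge_1: "j < L \<Longrightarrow> 1 \<le> real (site S (Suc j)) - real (site S j)"
  using site_less_Suc[of j] by linarith

lemma admissible_one: "hb L S j \<noteq> 0 \<Longrightarrow> 1 \<le> pi / hb L S j"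
  using hb_gap[of j] gap_ge_1[of j] by simp

lemma string_cancellation:
  assumes j: "j \<le> L" and M: "M \<in> Rj L S j"
  shows "(if j < L then gamma_Psi (hb L S j) (real (site S (Suc j)) - real M) (S (Suc j)) (S i) l else 0)
    + (if 1 \<le> j then gamma_Psi (hb L S j) (real M - real (site S j)) (S j) (S i) l else 0) = Psi M (S i) l"
proof -
  have M1: "site S j < M" and M2: "j < L \<Longrightarrow> M < site S (Suc j)"
    using M by (auto simp: Rj_def sb_eq_site)
  have Psi: "Psi M (S i) l = (LINT p|lborel. Psi_hat M (S i) p * cos (p * l))"
    unfolding Psi_eq_cos_integral by (simp add: mult.commute)
  \<comment> \<open>For \<open>j = 0\<close> the site 0 may be added, since \<open>Psi_hat\<close>
    vanishes there; the first gap then needs no separate treatment.\<close>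
  have left: "(if 1 \<le> j then gamma_Psi (hb L S j) (real M - real (site S j)) (S j) (S i) l else 0)
      = gamma_Psi (hb L S j) (real M - real (site S j)) (site S j) (S i) l"
    by (simp add: site_def gamma_Psi_def Psi_hat_zero)
  show ?thesis
  proof (cases "j < L")
    case True
    have int: "integrable lborel (\<lambda>p. gamma_hat (hb L S j) (real (site S (Suc j)) - real M) p * Psi_hat (site S (Suc j)) (S i) p * cos (p * l))"
      "integrable lborel (\<lambda>p. gamma_hat (hb L S j) (real M - real (site S j)) p * Psi_hat (site S j) (S i) p * cos (p * l))"
      using M1 M2[OF True] by (intro integrable_gamma_hat_Psi_hat hb_nonneg; simp add: hb_gap)+
    have "gamma_Psi (hb L S j) (real (site S (Suc j)) - real M) (site S (Suc j)) (S i) l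
        + gamma_Psi (hb L S j) (real M - real (site S j)) (site S j) (S i) l
      = (LINT p|lborel. gamma_hat (hb L S j) (real (site S (Suc j)) - real M) p * Psi_hat (site S (Suc j)) (S i) p * cos (p * l)
          + gamma_hat (hb L S j) (real M - real (site S j)) p * Psi_hat (site S j) (S i) p * cos (p * l))"
      unfolding gamma_Psi_def using int by simp
    also have "\<dots> = (LINT p|lborel. Psi_hat M (S i) p * cos (p * l))"
    proof (rule integral_cong_AE)
      show "AE p in lborel. gamma_hat (hb L S j) (real (site S (Suc j)) - real M) p * Psi_hat (site S (Suc j)) (S i) p * cos (p * l)
          + gamma_hat (hb L S j) (real M - real (site S j)) p * Psi_hat (site S j) (S i) p * cos (p * l)
          = Psi_hat M (S i) p * cos (p * l)"
        using AE_lborel_singleton[of "0::real"]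
      proof eventually_elim
        case (elim p)
        then show ?case
          using Psi_hat_interpolation[OF site_less_Suc[OF True] _ _ target_outside_gap[OF True] _ hb_eq[OF True], of M p] M1 M2[OF True]
          by (simp add: distrib_right[symmetric] add.commute)
      qed
    qed auto
    finally show ?thesis unfolding left Psi using True by (simp add: site_pos)
  next
    case False
    then have jL: "j = L" using j by simp
    have "(LINT p|lborel. gamma_hat (hb L S j) (real M - real (site S j)) p * Psi_hat (site S j) (S i) p * cos (p * l))
      = (LINT p|lborel. Psi_hat M (S i) p * cos (p * l))"
    proof (rule integral_cong_AE)
      show "AE p in lborel. gamma_hat (hb L S j) (real M - real (site S j)) p * Psi_hat (site S j) (S i) p * cos (p * l)
          = Psi_hat M (S i) p * cos (p * l)"
        using AE_lborel_singleton[of "0::real"]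
      proof eventually_elim
        case (elim p)
        then show ?case
          using Psi_hat_outer[of "S i" "site S j" M p] site_mono[of i L] i M1 jL by (simp add: hb_last site_pos)
      qed
    qed auto
    then show ?thesis unfolding left Psi using False by (simp add: gamma_Psi_def)
  qed
qed

text \<open>The total backflow energy of one hole at site \<open>j\<close> with rapidity
  \<open>l\<close>, collected from the densities at the right neighbour, at the left neighbour and
  at the site itself.\<close>

definition hole_sum :: "nat \<Rightarrow> real \<Rightarrow> real" where
  "hole_sum j l =
     (if j < L then kappa_Psi (hb L S j) (real (site S (Suc j)) - real (site S j) - 1) (S (Suc j)) (S i) l else 0)
   + (if 2 \<le> j then kappa_Psi (hb L S (j - 1)) (real (site S j) - real (site S (j - 1)) - 1) (S (j - 1)) (S i) l else 0)
   + (kappa_Psi (hb L S j) 1 (S j) (S i) l + kappa_Psi (hb L S (j - 1)) 1 (S j) (S i) l)"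

text \<open>Interpolation in the gap to the right of the site gives \<open>Psi_hat\<close> at
  \<open>S j + 1\<close>, in the gap to the left at \<open>S j - 1\<close>. With the common factor
  \<open>1 / (2 * cosh (p / 2))\<close> of \<open>kappa_hat\<close> and the subtracted
  \<open>Psi\<close>, the integrand is the left side of \<open>Psi_hat_defect\<close>.\<close>

lemma hole_sum_eq:
  assumes j: "1 \<le> j" "j \<le> L"
  shows "hole_sum j l - Psi (S j) (S i) l = - (if j = i then pi / cosh (pi * l) else 0)"
proof -
  define F where "F M p = Psi_hat M (S i) p" for M p
  obtain k where k: "j = Suc k" "k < L" using j by (cases j) auto
  define A where "A p = (if j < L then kappa_hat (hb L S j) (real (site S (Suc j)) - real (site S j) - 1) p * F (site S (Suc j)) p * cos (p * l) else 0)" for p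
  define B where "B p = kappa_hat (hb L S k) (real (site S j) - real (site S k) - 1) p * F (site S k) p * cos (p * l)" for p
  define C1 where "C1 p = kappa_hat (hb L S j) 1 p * F (site S j) p * cos (p * l)" for p
  define C2 where "C2 p = kappa_hat (hb L S k) 1 p * F (site S j) p * cos (p * l)" for p
  define E where "E p = F (site S j) p * cos (p * l)" for p
  have int: "integrable lborel A" "integrable lborel B" "integrable lborel C1" "integrable lborel C2" "integrable lborel E"
  proof -
    show "integrable lborel A"
    proof (cases "j < L")
      case True
      then show ?thesis unfolding A_def[abs_def] F_def using gap_ge_1[of j] hb_gap[of j]
        by (simp, intro integrable_kappa_hat_Psi_hat hb_nonneg) auto
    qed (simp add: A_def[abs_def])
    show "integrable lborel B" unfolding B_def[abs_def] F_def k(1) using gap_ge_1[of k] hb_gap[of k] k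
      by (intro integrable_kappa_hat_Psi_hat hb_nonneg) auto
    show "integrable lborel C1" "integrable lborel C2"
      unfolding C1_def[abs_def] C2_def[abs_def] F_def by (intro integrable_kappa_hat_Psi_hat hb_nonneg admissible_one; simp)+
    show "integrable lborel E" unfolding E_def[abs_def] F_def by (rule integrable_mult_cos[OF integrable_Psi_hat])
  qed
  have "hole_sum j l - Psi (S j) (S i) l = (LINT p|lborel. A p) + (LINT p|lborel. B p) + ((LINT p|lborel. C1 p) + (LINT p|lborel. C2 p)) - (LINT p|lborel. E p)"
  proof -
    \<comment> \<open>For \<open>j = 1\<close> the left neighbour is site 0, and \<open>B\<close> is
      then identically 0.\<close>
    have "(if 2 \<le> j then kappa_Psi (hb L S (j - 1)) (real (site S j) - real (site S (j - 1)) - 1) (S (j - 1)) (S i) l else 0) = (LINT p|lborel. B p)"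
      by (cases k) (auto simp: B_def k(1) kappa_Psi_def F_def site_def Psi_hat_zero)
    moreover have "(if j < L then kappa_Psi (hb L S j) (real (site S (Suc j)) - real (site S j) - 1) (S (Suc j)) (S i) l else 0) = (LINT p|lborel. A p)"
      by (auto simp: A_def kappa_Psi_def F_def site_pos)
    moreover have "Psi (S j) (S i) l = (LINT p|lborel. E p)"
      unfolding E_def F_def Psi_eq_cos_integral site_pos[OF j(1)] by (simp add: mult.commute)
    moreover have "kappa_Psi (hb L S j) 1 (S j) (S i) l = (LINT p|lborel. C1 p)"
      "kappa_Psi (hb L S (j - 1)) 1 (S j) (S i) l = (LINT p|lborel. C2 p)"
      by (simp_all add: kappa_Psi_def C1_def C2_def F_def k(1) site_pos)
    ultimately show ?thesis unfolding hole_sum_def by simp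
  qed
  also have "\<dots> = (LINT p|lborel. A p + B p + (C1 p + C2 p) - E p)"
    using int by simp
  also have "\<dots> = (LINT p|lborel. - (if j = i then cos (p * l) / (2 * cosh (p / 2)) else 0))"
  proof (rule integral_cong_AE)
    show "AE p in lborel. A p + B p + (C1 p + C2 p) - E p = - (if j = i then cos (p * l) / (2 * cosh (p / 2)) else 0)"
      using AE_lborel_singleton[of "0::real"]
    proof eventually_elim
      case (elim p)
      let ?c = "2 * cosh (p / 2) :: real"
      have right: "gamma_hat (hb L S j) 1 p * F (site S j) p
          + (if j < L then gamma_hat (hb L S j) (real (site S (Suc j)) - real (site S j) - 1) p * F (site S (Suc j)) p else 0)
          = F (site S j + 1) p"
      proof (cases "j < L")
        case True
        then show ?thesis
          using Psi_hat_interpolation[OF site_less_Suc[OF True] _ _ target_outside_gap[OF True] elim hb_eq[OF True], of "site S j + 1"]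
            site_less_Suc[OF True] by (simp add: F_def algebra_simps)
      next
        case False
        then have "j = L" using j by simp
        then show ?thesis
          using Psi_hat_outer[of "S i" "site S j" "site S j + 1" p] elim site_mono[of i L] i
          by (simp add: F_def hb_last site_pos)
      qed
      have "site S k < site S j" using site_less_Suc[OF k(2)] k by simp
      then have left: "gamma_hat (hb L S k) (real (site S j) - real (site S k) - 1) p * F (site S k) p
          + gamma_hat (hb L S k) 1 p * F (site S j) p = F (site S j - 1) p"
        using Psi_hat_interpolation[OF site_less_Suc[OF k(2)] _ _ target_outside_gap[OF k(2)] elim hb_eq[OF k(2)], of "site S j - 1"]
        by (simp add: F_def k(1) of_nat_diff algebra_simps)
      have "A p + B p + (C1 p + C2 p) - E p = ((F (site S j + 1) p + F (site S j - 1) p) / ?c - F (site S j) p) * cos (p * l)"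
        unfolding right[symmetric] left[symmetric] A_def B_def C1_def C2_def E_def kappa_hat_def
        by (simp add: field_simps)
      also have "(F (site S j + 1) p + F (site S j - 1) p) / ?c - F (site S j) p = - (if site S j = S i then 1 / ?c else 0)"
        unfolding F_def using pos[OF j] pos[OF i] elim j by (intro Psi_hat_defect) (auto simp: site_pos)
      also have "site S j = S i \<longleftrightarrow> j = i"
        using site_strict_mono[of i j] site_strict_mono[of j i] i j by (metis linorder_cases less_irrefl site_pos)
      finally show ?case by simp
    qed
    show "(\<lambda>p. A p + B p + (C1 p + C2 p) - E p) \<in> borel_measurable lborel"
      using int by (intro borel_measurable_add borel_measurable_diff borel_measurable_integrable)
    show "(\<lambda>p. - (if j = i then cos (p * l) / (2 * cosh (p / 2)) else 0)) \<in> borel_measurable lborel"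
      unfolding cosh_field_def by measurable
  qed
  also have "\<dots> = - (if j = i then pi / cosh (pi * l) else 0)"
    by (simp add: cos_integral_sech)
  finally show ?thesis .
qed

text \<open>Every summand is Lebesgue integrable, so the gauge integral in \<open>DeltaE\<close>
  splits termwise; the factors \<open>2 * pi\<close> from Parseval cancel the prefactors of
  \<open>rreg\<close> and \<open>cfun\<close>.\<close>

lemma site_integral:
  assumes j: "1 \<le> j" "j \<le> L"
  shows "integral UNIV (\<lambda>x. (rreg L S D lt j x + cfun L S nu lam j x) * Psi (S j) (S i) x) =
      (\<Sum>d = 1..Dc L D (j - 1). kappa_Psi (hb L S (j - 1)) (real (site S j) - real (site S (j - 1)) - 1) (S j) (S i) (lt (j - 1) d))
    + (\<Sum>d = 1..Dc L D (Suc j). kappa_Psi (hb L S j) (real (site S (Suc j)) - real (site S j) - 1) (S j) (S i) (lt (Suc j) d))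
    + (\<Sum>d = 1..Dc L D j. kappa_Psi (hb L S j) 1 (S j) (S i) (lt j d) + kappa_Psi (hb L S (j - 1)) 1 (S j) (S i) (lt j d))
    - ((\<Sum>M \<in> {M \<in> Rj L S (j - 1). 0 < nu M}. \<Sum>l = 1..nu M.
          gamma_Psi (hb L S (j - 1)) (real (site S j) - real M) (S j) (S i) (lam M l))
     + (\<Sum>M \<in> {M \<in> Rj L S j. 0 < nu M}. \<Sum>l = 1..nu M.
          gamma_Psi (hb L S j) (real M - real (site S j)) (S j) (S i) (lam M l)))"
    (is "_ = ?K1 + ?K2 + ?K3 - (?G1 + ?G2)")
proof -
  obtain k where k: "j = Suc k" "k < L" using j by (cases j) auto
  let ?P = "Psi (S j) (S i)"
  have gap: "2 * (sb S a - sb S b) - 1 = real (site S a) - real (site S b) - 1"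
    "2 * (sb S a - real M / 2) = real (site S a) - real M" "2 * (real M / 2 - sb S a) = real M - real (site S a)" for a b M
    by (simp_all add: sb_eq_site)
  define T1 T2 T3 T4 T5 where
    "T1 x = (\<Sum>d = 1..Dc L D (j - 1). kappa (hb L S (j - 1)) (real (site S j) - real (site S (j - 1)) - 1) (x - lt (j - 1) d))"
    "T2 x = (\<Sum>d = 1..Dc L D (Suc j). kappa (hb L S j) (real (site S (Suc j)) - real (site S j) - 1) (x - lt (Suc j) d))"
    "T3 x = (\<Sum>d = 1..Dc L D j. kappa (hb L S j) 1 (x - lt j d) + kappa (hb L S (j - 1)) 1 (x - lt j d))"
    "T4 x = (\<Sum>M \<in> {M \<in> Rj L S (j - 1). 0 < nu M}. \<Sum>l = 1..nu M.
          gamma_fn (hb L S (j - 1)) (real (site S j) - real M) (x - lam M l))"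
    "T5 x = (\<Sum>M \<in> {M \<in> Rj L S j. 0 < nu M}. \<Sum>l = 1..nu M.
          gamma_fn (hb L S j) (real M - real (site S j)) (x - lam M l))" for x
  note T_defs = this
  have 1: "has_bochner_integral lborel (\<lambda>x. T1 x * ?P x) (2 * pi * ?K1)"
    unfolding T_defs sum_distrib_right sum_distrib_left
    using gap_ge_1[OF k(2)] hb_gap[of k]
    by (intro has_bochner_integral_sum has_bochner_integral_kappa_Psi hb_nonneg) (auto simp: k(1))
  have 2: "has_bochner_integral lborel (\<lambda>x. T2 x * ?P x) (2 * pi * ?K2)"
  proof (cases "j < L")
    case True
    show ?thesis
      unfolding T_defs sum_distrib_right sum_distrib_left
      using gap_ge_1[OF True] hb_gap[of j]
      by (intro has_bochner_integral_sum has_bochner_integral_kappa_Psi hb_nonneg) auto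
  next
    case False
    \<comment> \<open>There are no holes at index \<open>L + 1\<close>, so the sum is empty although
      its kernel has no meaningful right end.\<close>
    then show ?thesis by (simp add: T_defs Dc_def has_bochner_integral_zero)
  qed
  have 3: "has_bochner_integral lborel (\<lambda>x. T3 x * ?P x) (2 * pi * ?K3)"
    unfolding T_defs sum_distrib_right sum_distrib_left distrib_right distrib_left
    by (intro has_bochner_integral_sum has_bochner_integral_add has_bochner_integral_kappa_Psi hb_nonneg admissible_one) auto
  have 4: "has_bochner_integral lborel (\<lambda>x. T4 x * ?P x) (2 * pi * ?G1)"
    unfolding T_defs sum_distrib_right sum_distrib_left
  proof (intro has_bochner_integral_sum has_bochner_integral_gamma_Psi hb_nonneg)
    fix M assume "M \<in> {M \<in> Rj L S (j - 1). 0 < nu M}"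
    then have M: "site S k < M" "M < site S j" using k by (auto simp: Rj_def sb_eq_site)
    then show "0 < real (site S j) - real M" by simp
    assume "hb L S (j - 1) \<noteq> 0"
    then show "real (site S j) - real M < pi / hb L S (j - 1)"
      using M hb_gap[of k] k by simp
  qed
  have 5: "has_bochner_integral lborel (\<lambda>x. T5 x * ?P x) (2 * pi * ?G2)"
    unfolding T_defs sum_distrib_right sum_distrib_left
  proof (intro has_bochner_integral_sum has_bochner_integral_gamma_Psi hb_nonneg)
    fix M assume M: "M \<in> {M \<in> Rj L S j. 0 < nu M}"
    then show "0 < real M - real (site S j)" by (auto simp: Rj_def sb_eq_site)
    assume "hb L S j \<noteq> 0"
    then show "real M - real (site S j) < pi / hb L S j"
      using M hb_gap[of j] by (auto simp: Rj_def sb_eq_site)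
  qed
  have "(rreg L S D lt j x + cfun L S nu lam j x) * ?P x
      = 1 / (2 * pi) * (T1 x * ?P x + T2 x * ?P x + T3 x * ?P x - (T4 x * ?P x + T5 x * ?P x))" for x
    unfolding rreg_def cfun_def gap T_defs[symmetric] by (simp add: field_simps)
  moreover have "has_bochner_integral lborel
     (\<lambda>x. 1 / (2 * pi) * (T1 x * ?P x + T2 x * ?P x + T3 x * ?P x - (T4 x * ?P x + T5 x * ?P x)))
     (1 / (2 * pi) * (2 * pi * ?K1 + 2 * pi * ?K2 + 2 * pi * ?K3 - (2 * pi * ?G1 + 2 * pi * ?G2)))"
    by (intro has_bochner_integral_mult_right has_bochner_integral_add has_bochner_integral_diff 1 2 3 4 5)
  ultimately have "has_bochner_integral lborel (\<lambda>x. (rreg L S D lt j x + cfun L S nu lam j x) * ?P x)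
     (1 / (2 * pi) * (2 * pi * (?K1 + ?K2 + ?K3 - (?G1 + ?G2))))"
    by (simp only: distrib_left right_diff_distrib)
  then have "has_bochner_integral lborel (\<lambda>x. (rreg L S D lt j x + cfun L S nu lam j x) * ?P x)
     (?K1 + ?K2 + ?K3 - (?G1 + ?G2))"
    by simp
  then show ?thesis
    by (simp only: has_bochner_integral_iff integral_lborel)
qed

lemma Rj_disjoint:
  assumes "j < k" "k \<le> L"
  shows "Rj L S j \<inter> Rj L S k = {}"
  using assms site_mono[of "Suc j" k] by (auto simp: Rj_def sb_eq_site)

lemma DeltaE_eq:
  assumes fin: "finite {M \<in> Rall L S. 0 < nu M}"
  shows "DeltaE L S D lt nu lam i = (\<Sum>d = 1..D i. pi / cosh (pi * lt i d))"
proof -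
  define X where "X j = (\<Sum>d = 1..Dc L D j. kappa_Psi (hb L S j) (real (site S (Suc j)) - real (site S j) - 1) (S (Suc j)) (S i) (lt j d))" for j
  define Y where "Y j = (\<Sum>d = 1..Dc L D j. kappa_Psi (hb L S (j - 1)) (real (site S j) - real (site S (j - 1)) - 1) (S (j - 1)) (S i) (lt j d))" for j
  define Z where "Z j = (\<Sum>d = 1..Dc L D j. kappa_Psi (hb L S j) 1 (S j) (S i) (lt j d) + kappa_Psi (hb L S (j - 1)) 1 (S j) (S i) (lt j d))" for j
  define R where "R j = {M \<in> Rj L S j. 0 < nu M}" for j
  define U where "U j = (\<Sum>M\<in>R j. \<Sum>l = 1..nu M. gamma_Psi (hb L S j) (real (site S (Suc j)) - real M) (S (Suc j)) (S i) (lam M l))" for j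
  define V where "V j = (\<Sum>M\<in>R j. \<Sum>l = 1..nu M. gamma_Psi (hb L S j) (real M - real (site S j)) (S j) (S i) (lam M l))" for j
  let ?I = "\<lambda>j. integral UNIV (\<lambda>x. (rreg L S D lt j x + cfun L S nu lam j x) * Psi (S j) (S i) x)"
  have "(\<Sum>j = 1..L. ?I j) = (\<Sum>j = 1..L. X (j - 1) + Y (Suc j) + Z j - (U (j - 1) + V j))"
    by (rule sum.cong) (auto simp: site_integral X_def Y_def Z_def U_def V_def R_def)
  also have "\<dots> = (\<Sum>j = 1..L. X (j - 1)) + (\<Sum>j = 1..L. Y (Suc j)) + (\<Sum>j = 1..L. Z j) - (\<Sum>j = 1..L. U (j - 1) + V j)"
    by (simp only: sum.distrib sum_subtractf)
  also have "(\<Sum>j = 1..L. X (j - 1)) = (\<Sum>j = 1..L. if j < L then X j else 0)"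
    by (rule sum_shift_down) (simp add: X_def Dc_def)
  also have "(\<Sum>j = 1..L. Y (Suc j)) = (\<Sum>j = 1..L. if 2 \<le> j then Y j else 0)"
    by (rule sum_shift_up) (simp add: Y_def Dc_def)
  also have "(\<Sum>j = 1..L. U (j - 1) + V j) = (\<Sum>M\<in>{M \<in> Rall L S. 0 < nu M}. \<Sum>l = 1..nu M. Psi M (S i) (lam M l))"
  proof -
    have "(\<Sum>j = 1..L. U (j - 1) + V j) = (\<Sum>j = 0..L. (if j < L then U j else 0) + (if 1 \<le> j then V j else 0))"
      by (rule sum_shift_both)
    also have "\<dots> = (\<Sum>j = 0..L. \<Sum>M\<in>R j. \<Sum>l = 1..nu M. Psi M (S i) (lam M l))"
    proof (rule sum.cong)
      fix j assume j: "j \<in> {0..L}"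
      have "(if j < L then U j else 0) + (if 1 \<le> j then V j else 0) = (\<Sum>M\<in>R j. \<Sum>l = 1..nu M.
          (if j < L then gamma_Psi (hb L S j) (real (site S (Suc j)) - real M) (S (Suc j)) (S i) (lam M l) else 0)
        + (if 1 \<le> j then gamma_Psi (hb L S j) (real M - real (site S j)) (S j) (S i) (lam M l) else 0))"
        by (simp add: U_def V_def sum.distrib)
      also have "\<dots> = (\<Sum>M\<in>R j. \<Sum>l = 1..nu M. Psi M (S i) (lam M l))"
        using j by (intro sum.cong refl string_cancellation) (auto simp: R_def)
      finally show "(if j < L then U j else 0) + (if 1 \<le> j then V j else 0) = (\<Sum>M\<in>R j. \<Sum>l = 1..nu M. Psi M (S i) (lam M l))" .
    qed simp
    also have "\<dots> = (\<Sum>M\<in>(\<Union>j\<in>{0..L}. R j). \<Sum>l = 1..nu M. Psi M (S i) (lam M l))"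
    proof (rule sum.UNION_disjoint[symmetric])
      \<comment> \<open>The last gap is unbounded; the set of occupied strings in it is finite by
        \<open>fin\<close>.\<close>
      show "\<forall>j\<in>{0..L}. finite (R j)"
        by (intro ballI finite_subset[OF _ fin]) (unfold R_def Rall_def, blast)
      show "\<forall>j\<in>{0..L}. \<forall>k\<in>{0..L}. j \<noteq> k \<longrightarrow> R j \<inter> R k = {}"
      proof (intro ballI impI)
        fix j k assume "j \<in> {0..L}" "k \<in> {0..L}" "j \<noteq> k"
        then have "Rj L S j \<inter> Rj L S k = {}"
          using Rj_disjoint[of j k] Rj_disjoint[of k j] by (cases "j < k") auto
        then show "R j \<inter> R k = {}" unfolding R_def by blast
      qed
    qed simp
    also have "(\<Union>j\<in>{0..L}. R j) = {M \<in> Rall L S. 0 < nu M}" by (auto simp: R_def Rall_def)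
    finally show ?thesis .
  qed
  also have "(\<Sum>j = 1..L. if j < L then X j else 0) + (\<Sum>j = 1..L. if 2 \<le> j then Y j else 0) + (\<Sum>j = 1..L. Z j)
      = (\<Sum>j = 1..L. \<Sum>d = 1..Dc L D j. hole_sum j (lt j d))"
  proof -
    have "(if j < L then X j else 0) + (if 2 \<le> j then Y j else 0) + Z j = (\<Sum>d = 1..Dc L D j. hole_sum j (lt j d))" for j
      by (simp add: X_def Y_def Z_def hole_sum_def sum.distrib)
    then show ?thesis by (simp only: sum.distrib[symmetric])
  qed
  finally have I: "(\<Sum>j = 1..L. ?I j) = (\<Sum>j = 1..L. \<Sum>d = 1..Dc L D j. hole_sum j (lt j d))
      - (\<Sum>M\<in>{M \<in> Rall L S. 0 < nu M}. \<Sum>l = 1..nu M. Psi M (S i) (lam M l))" .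
  \<comment> \<open>The string sum enters \<open>I\<close> with a minus sign, which
    \<open>DeltaE\<close> reverses, and so cancels the bare string energies; only holes
    remain.\<close>
  have "DeltaE L S D lt nu lam i
      = - (\<Sum>j = 1..L. \<Sum>d = 1..Dc L D j. hole_sum j (lt j d) - Psi (S j) (S i) (lt j d))"
    unfolding DeltaE_def sum_subtractf I by simp
  also have "\<dots> = - (\<Sum>j = 1..L. \<Sum>d = 1..Dc L D j. - (if j = i then pi / cosh (pi * lt j d) else 0))"
    by (intro arg_cong[where f = uminus] sum.cong refl hole_sum_eq) auto
  also have "\<dots> = (\<Sum>j = 1..L. if j = i then \<Sum>d = 1..Dc L D j. pi / cosh (pi * lt j d) else 0)"
    unfolding sum_negf[symmetric] by (intro sum.cong) auto
  also have "\<dots> = (\<Sum>d = 1..D i. pi / cosh (pi * lt i d))"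
    using i by (simp add: Dc_def)
  finally show ?thesis .
qed

end

theorem theorem6p1:
  fixes L :: nat and S :: "nat \<Rightarrow> nat" and D :: "nat \<Rightarrow> nat"
    and lt :: "nat \<Rightarrow> nat \<Rightarrow> real" and nu :: "nat \<Rightarrow> nat"
    and lam :: "nat \<Rightarrow> nat \<Rightarrow> real" and j :: nat
  assumes pos: "\<And>i. 1 \<le> i \<Longrightarrow> i \<le> L \<Longrightarrow> 0 < S i"
    and incr: "\<And>i. 1 \<le> i \<Longrightarrow> i < L \<Longrightarrow> S i < S (Suc i)"
    and fin: "finite {M \<in> Rall L S. 0 < nu M}"
    and j: "1 \<le> j" "j \<le> L"
  shows "DeltaE L S D lt nu lam j = (\<Sum>d = 1..D j. pi / cosh (pi * lt j d))"
proof -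
  interpret spin_chain L S j
    using pos incr j by unfold_locales
  show ?thesis using fin by (rule DeltaE_eq)
qed

end
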